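(* Let $r\ge1$ be a fixed integer and let $\Pi=(\Pi_1,\dots,\Pi_\ell)$ be an $[r]$-pattern in which every color of $[r]$ appears. Consider the randomly $[r]$-colored directed random graph process $D_0^r,D_1^r,\dots,D_{N'}^r$ on $[n]$ with $\ell\mid n$. Let $\overrightarrow{\tau}_{\Pi-connected}$ be the least $i$ such that $D_i^r$ is $\Pi$-connected, and $\overrightarrow{\tau}_1$ the least $i$ such that every vertex of $D_i$ has in-degree at least $1$ and out-degree at least $1$. Then with high probability $\overrightarrow{\tau}_{\Pi-connected}=\overrightarrow{\tau}_1$.
   Context: The colored directed random graph process: let $N'=n(n-1)$. $D_0$ is the empty digraph on $[n]$, and for $i\in[N']$, $D_i$ is obtained from $D_{i-1}$ by adding an arc chosen uniformly at random among the arcs not in $D_{i-1}$; independently it receives a color chosen uniformly at random from $[r]$; $D_i^r$ is $D_i$ with these colors. An $[r]$-pattern is a finite sequence $\Pi=(\Pi_1,\dots,\Pi_\ell)$ with entries in $[r]$, indices taken cyclically. A directed path with consecutive arcs $f_1,\dots,f_k$ is $\Pi$-colored if there is $0\le l\le\ell-1$ such that $f_j$ has color $\Pi_{j+l}$ for all $j\in[k]$. The colored digraph is $\Pi$-connected if for every ordered pair of distinct vertices $(u,v)$ there is a $\Pi$-colored directed path from $u$ to $v$ (the directed analog of $\Pi$-connectivity, with strong connectivity replacing connectivity). "With high probability" means with probability tending to $1$ as $n\to\infty$. *)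

theory Defs
  imports "HOL-Probability.Probability" "Graph_Theory.Graph_Theory"
begin

type_synonym arc = "nat \<times> nat"

definition all_arcs :: "nat \<Rightarrow> arc set" where
  "all_arcs n = {(u, v). u \<in> {1..n} \<and> v \<in> {1..n} \<and> u \<noteq> v}"

(* The history of the first i steps: the arcs in order of insertion, each with its color.
   Meaningful for i <= n * (n - 1) only: later on no arc is left to choose. *)
primrec colored_process :: "nat \<Rightarrow> nat \<Rightarrow> nat \<Rightarrow> (arc \<times> nat) list pmf" where
  "colored_process r n 0 = return_pmf []"
| "colored_process r n (Suc i) =
     bind_pmf (colored_process r n i) (\<lambda>h.
     bind_pmf (pmf_of_set (all_arcs n - fst ` set h)) (\<lambda>e.
     bind_pmf (pmf_of_set {1..r}) (\<lambda>c.
     return_pmf (h @ [(e, c)]))))"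

definition full_process :: "nat \<Rightarrow> nat \<Rightarrow> (arc \<times> nat) list pmf" where
  "full_process r n = colored_process r n (n * (n - 1))"

definition D :: "nat \<Rightarrow> (arc \<times> nat) list \<Rightarrow> nat \<Rightarrow> (nat, arc) pre_digraph" where
  "D n h i = \<lparr>verts = {1..n}, arcs = fst ` set (take i h), tail = fst, head = snd\<rparr>"

(* An arc is inserted only once and keeps its color, so the coloring of D n h i is the
   restriction of a coloring that does not depend on i. *)
definition coloring :: "(arc \<times> nat) list \<Rightarrow> arc \<Rightarrow> nat" where
  "coloring h e = the (map_of h e)"

(* Arcs f_1, ..., f_k and pattern entries are indexed from 0 here; since the shift l ranges
   over a full period, this agrees with the indexing from 1. *)
definition pattern_colored :: "nat list \<Rightarrow> ('b \<Rightarrow> nat) \<Rightarrow> 'b list \<Rightarrow> bool" where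
  "pattern_colored P col p \<longleftrightarrow>
     (\<exists>l<length P. \<forall>j<length p. col (p ! j) = P ! ((j + l) mod length P))"

(* apath: a directed path given by its list of arcs, with pairwise distinct vertices *)
definition pattern_connected :: "nat list \<Rightarrow> ('a, 'b) pre_digraph \<Rightarrow> ('b \<Rightarrow> nat) \<Rightarrow> bool" where
  "pattern_connected P G col \<longleftrightarrow>
     (\<forall>u\<in>verts G. \<forall>v\<in>verts G. u \<noteq> v \<longrightarrow>
        (\<exists>p. pre_digraph.apath G u p v \<and> pattern_colored P col p))"

(* For n >= 2 and a pattern containing every color, the complete digraph D n h (n * (n - 1))
   satisfies the conditions defining both hitting times (single arcs are pattern colored),
   so both minima exist. *)
definition tau_connected :: "nat list \<Rightarrow> nat \<Rightarrow> (arc \<times> nat) list \<Rightarrow> nat" where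
  "tau_connected P n h = (LEAST i. pattern_connected P (D n h i) (coloring h))"

definition tau_1 :: "nat \<Rightarrow> (arc \<times> nat) list \<Rightarrow> nat" where
  "tau_1 n h =
     (LEAST i. \<forall>v\<in>verts (D n h i). in_degree (D n h i) v \<ge> 1 \<and> out_degree (D n h i) v \<ge> 1)"

end

theory Submission
  imports Defs "HOL-Real_Asymp.Real_Asymp"
begin

text \<open>
  Give each arc an independent mark: \<open>0\<close> with probability about \<open>(1 - \<eta>) ln n / n\<close>, at most \<open>1\<close>
  with probability \<open>2 ln n / n\<close>. Conditioned on the marks, ordering the arcs uniformly among the orders
  in which marks increase gives exactly the random process, so that the arcs of mark \<open>0\<close> and of mark at
  most \<open>1\<close> are the arc sets of the process at two random times. With high probability the hitting
  time of minimum in- and out-degree one lies between them, and the whole argument takes place in a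
  product space.

  Fix five disjoint zones of vertices, each split into \<open>\<ell>\<close> blocks of linear size, and in each zone keep
  only the arcs of mark \<open>0\<close> from block \<open>i\<close> to block \<open>i + 1\<close> (cyclically) with color \<open>\<Pi>\<^sub>i\<close>. The block of a
  vertex determines its position in the pattern, so every walk in this digraph is colored correctly and
  shortens to a path with the same property. Any two linear-sized sets in consecutive blocks
  are joined by an arc; hence, splitting a set that reaches much into two parts, one of which still reaches
  much, most vertices of each block reach, and are reached from, many vertices, and all these are connected.

  A vertex \<open>u\<close> outside the zone has an out-neighbor \<open>w\<close>, and \<open>w\<close> fails to have an arc of the prescribed color to
  a well-connected vertex of the next block with probability at most \<open>n\<close> to the power \<open>-\<gamma>\<close>, independently of the arcs at
  \<open>u\<close> and inside the zone. If \<open>u\<close> has small out-degree, which has probability about \<open>1/n\<close> up to a factor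
  \<open>n\<close> to the power \<open>2\<eta>\<close>, then one such \<open>w\<close> is enough for the union bound as \<open>2\<eta> < \<gamma>\<close>; otherwise \<open>u\<close> has many
  out-neighbors and not too many of them fail. The same holds for in-neighbors \<open>z\<close> of \<open>v\<close>. Five zones
  suffice to choose one that avoids \<open>u\<close>, \<open>w\<close>, \<open>z\<close>, \<open>v\<close>, and then \<open>u, w, \<dots>, z, v\<close> is a path.
\<close>

section \<open>Expanding layers\<close>

text \<open>Blocks will have \<open>4 * s\<close> vertices, so \<open>2 * s\<close> is half a block.
  It is also twice the size at which \<open>expanding\<close> applies: when a set of reach
  \<open>2 * s\<close> is split in two, one part keeps reach \<open>s\<close>, and one more step
  raises that to \<open>2 * s\<close> again.\<close>

definition spreading :: "('a \<times> 'a) set \<Rightarrow> (nat \<Rightarrow> 'a set) \<Rightarrow> nat \<Rightarrow> nat \<Rightarrow> 'a set" where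
  "spreading R B l s = {x. \<exists>j<l. card (R\<^sup>* `` {x} \<inter> B j) \<ge> 2 * s}"

text \<open>The successor map \<open>nx\<close> is a parameter so that the same lemmas serve the
  layered digraph, with the cyclic successor, and its converse, with the cyclic predecessor.\<close>

definition expanding :: "('a \<times> 'a) set \<Rightarrow> (nat \<Rightarrow> 'a set) \<Rightarrow> (nat \<Rightarrow> nat) \<Rightarrow> nat \<Rightarrow> nat \<Rightarrow> bool" where
  "expanding R B nx l s \<longleftrightarrow>
     (\<forall>i<l. \<forall>S T. S \<subseteq> B i \<longrightarrow> T \<subseteq> B (nx i) \<longrightarrow> card S = s \<longrightarrow> card T = s \<longrightarrow>
        (\<exists>x\<in>S. \<exists>y\<in>T. (x, y) \<in> R))"

text \<open>Otherwise at least \<open>s\<close> vertices of the next block would be missed, and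
  together with \<open>s\<close> vertices of \<open>S\<close> they would form two sets without an
  arc between them.\<close>

lemma expanding_step:
  assumes ex: "expanding R B nx l s" and s: "s > 0"
    and fin: "\<And>i. i < l \<Longrightarrow> finite (B i)" and card: "\<And>i. i < l \<Longrightarrow> card (B i) = 4 * s"
    and nx: "\<And>i. i < l \<Longrightarrow> nx i < l"
    and i: "i < l" and S: "S \<subseteq> B i" "card S \<ge> s"
  shows "card (R `` S \<inter> B (nx i)) \<ge> 2 * s"
proof (rule ccontr)
  assume *: "\<not> ?thesis"
  have "card (B (nx i) - R `` S) + card (R `` S \<inter> B (nx i)) = card (B (nx i))"
    using card_Int_Diff[OF fin[OF nx[OF i]], of "R `` S"] by (simp add: Int_commute)
  then have "card (B (nx i) - R `` S) \<ge> s" using * card[OF nx[OF i]] by linarith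
  then obtain T where T: "T \<subseteq> B (nx i) - R `` S" "card T = s"
    by (meson obtain_subset_with_card_n)
  obtain S' where S': "S' \<subseteq> S" "card S' = s" using S(2) by (meson obtain_subset_with_card_n)
  have "S' \<subseteq> B i" "T \<subseteq> B (nx i)" using S S' T by blast+
  then obtain x y where "x \<in> S'" "y \<in> T" "(x, y) \<in> R"
    using ex[unfolded expanding_def, rule_format, OF i, of S' T] T S S' by auto
  then show False using T(1) S'(1) by blast
qed

text \<open>Vertices are removed from \<open>S\<close> one at a time. The removed vertex or the
  remaining set keeps reach \<open>s\<close>, and one step into the next block raises this to
  \<open>2 * s\<close>; the block index \<open>j\<close> therefore has to vary in the
  induction.\<close>

lemma expanding_exists_spreading:
  assumes ex: "expanding R B nx l s" and s: "s > 0"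
    and fin: "\<And>i. i < l \<Longrightarrow> finite (B i)" and card: "\<And>i. i < l \<Longrightarrow> card (B i) = 4 * s"
    and nx: "\<And>i. i < l \<Longrightarrow> nx i < l"
    and "finite S" "j < l" "card (R\<^sup>* `` S \<inter> B j) \<ge> 2 * s"
  shows "\<exists>x\<in>S. x \<in> spreading R B l s"
  using assms(6-8)
proof (induction S arbitrary: j rule: finite_induct)
  case empty
  then show ?case using s by simp
next
  case (insert x S)
  have step: "card (R\<^sup>* `` Y \<inter> B (nx j)) \<ge> 2 * s" if "card (R\<^sup>* `` Y \<inter> B j) \<ge> s" for Y
  proof -
    have "card (R `` (R\<^sup>* `` Y \<inter> B j) \<inter> B (nx j)) \<ge> 2 * s"
      using expanding_step[OF ex s fin card nx insert.prems(1) _ that] by blast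
    moreover have "R `` (R\<^sup>* `` Y \<inter> B j) \<inter> B (nx j) \<subseteq> R\<^sup>* `` Y \<inter> B (nx j)"
      by (auto intro: rtrancl_into_rtrancl)
    ultimately show ?thesis
      by (rule order_trans[OF _ card_mono[OF finite_Int[OF disjI2[OF fin[OF nx[OF insert.prems(1)]]]]]])
  qed
  have "R\<^sup>* `` insert x S \<inter> B j = (R\<^sup>* `` {x} \<inter> B j) \<union> (R\<^sup>* `` S \<inter> B j)" by auto
  then have "2 * s \<le> card (R\<^sup>* `` {x} \<inter> B j) + card (R\<^sup>* `` S \<inter> B j)"
    using insert.prems(2) card_Un_le[of "R\<^sup>* `` {x} \<inter> B j" "R\<^sup>* `` S \<inter> B j"] by simp
  then consider "card (R\<^sup>* `` {x} \<inter> B j) \<ge> s" | "card (R\<^sup>* `` S \<inter> B j) \<ge> s" by linarith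
  then show ?case
  proof cases
    case 1
    then show ?thesis using step[OF 1] nx[OF insert.prems(1)] by (auto simp: spreading_def)
  next
    case 2
    then show ?thesis using insert.IH[OF nx[OF insert.prems(1)] step[OF 2]] by blast
  qed
qed

text \<open>A set reaches itself, so \<open>2 * s\<close> non-spreading vertices of one block would
  have reach \<open>2 * s\<close> in that block and would have to contain a spreading
  vertex.\<close>

lemma expanding_card_spreading:
  assumes ex: "expanding R B nx l s" and s: "s > 0"
    and fin: "\<And>i. i < l \<Longrightarrow> finite (B i)" and card: "\<And>i. i < l \<Longrightarrow> card (B i) = 4 * s"
    and nx: "\<And>i. i < l \<Longrightarrow> nx i < l" and i: "i < l"
  shows "card (spreading R B l s \<inter> B i) \<ge> 2 * s"
proof -
  let ?N = "B i - spreading R B l s"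
  have "card ?N < 2 * s"
  proof (rule ccontr)
    assume "\<not> ?thesis"
    moreover have "?N \<subseteq> R\<^sup>* `` ?N \<inter> B i" by auto
    ultimately have "card (R\<^sup>* `` ?N \<inter> B i) \<ge> 2 * s"
      using card_mono[OF finite_Int[OF disjI2[OF fin[OF i]]], of ?N "R\<^sup>* `` ?N"] by linarith
    from expanding_exists_spreading[OF ex s fin card nx finite_Diff[OF fin[OF i]] i this]
    show False by auto
  qed
  moreover have "card (spreading R B l s \<inter> B i) + card ?N = 4 * s"
    using card_Int_Diff[OF fin[OF i], of "spreading R B l s"] card[OF i] by (simp add: Int_commute)
  ultimately show ?thesis by linarith
qed

text \<open>From \<open>x\<close>, the reach of \<open>2 * s\<close> is carried around the cycle
  into every block, in particular into the block preceding one in which many vertices reach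
  \<open>y\<close>; expansion supplies the connecting arc.\<close>

lemma expanding_link:
  assumes ex: "expanding R B (\<lambda>i. Suc i mod l) l s" and s: "s > 0"
    and fin: "\<And>i. i < l \<Longrightarrow> finite (B i)" and card: "\<And>i. i < l \<Longrightarrow> card (B i) = 4 * s"
    and x: "x \<in> spreading R B l s" and y: "y \<in> spreading (R\<inverse>) B l s"
  shows "(x, y) \<in> R\<^sup>*"
proof -
  obtain j j' where j: "j < l" "card (R\<^sup>* `` {x} \<inter> B j) \<ge> 2 * s"
    and j': "j' < l" "card ((R\<inverse>)\<^sup>* `` {y} \<inter> B j') \<ge> 2 * s"
    using x y by (auto simp: spreading_def)
  have l: "l > 0" using j by auto
  have *: "card (R\<^sup>* `` {x} \<inter> B ((j + m) mod l)) \<ge> 2 * s" for m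
  proof (induction m)
    case 0
    then show ?case using j by simp
  next
    case (Suc m)
    let ?i = "(j + m) mod l"
    have i: "?i < l" "Suc ?i mod l < l" using l by simp_all
    have "card (R `` (R\<^sup>* `` {x} \<inter> B ?i) \<inter> B (Suc ?i mod l)) \<ge> 2 * s"
      by (rule expanding_step[OF ex s fin card _ i(1)]) (use l Suc in auto)
    moreover have "R `` (R\<^sup>* `` {x} \<inter> B ?i) \<inter> B (Suc ?i mod l) \<subseteq> R\<^sup>* `` {x} \<inter> B (Suc ?i mod l)"
      by (auto intro: rtrancl_into_rtrancl)
    ultimately have "card (R\<^sup>* `` {x} \<inter> B (Suc ?i mod l)) \<ge> 2 * s"
      by (rule order_trans[OF _ card_mono[OF finite_Int[OF disjI2[OF fin[OF i(2)]]]]])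
    then show ?case by (simp add: mod_Suc_eq)
  qed
  \<comment> \<open>The block \<open>i\<close> is the cyclic predecessor of \<open>j'\<close>: the
    offset is congruent to \<open>j' - 1 - j\<close> modulo \<open>l\<close>, and the added multiple
    of \<open>l\<close> keeps the subtraction of \<open>j\<close> from truncating.\<close>
  define i where "i = (j + (l * l + l - 1 + j' - j)) mod l"
  have jl: "j \<le> l * l + l - 1 + j'" using j(1) l by (cases l) auto
  have eq: "j + (l * l + l - 1 + j' - j) = l * l + (l - 1) + j'" using jl l by simp
  have i: "i < l" using l by (simp add: i_def)
  have "Suc i mod l = Suc (l * l + (l - 1) + j') mod l" by (simp only: i_def eq mod_Suc_eq)
  also have "Suc (l * l + (l - 1) + j') = j' + l * (l + 1)" using l by (simp add: algebra_simps)
  also have "\<dots> mod l = j'" using j'(1) by (simp only: mod_mult_self2 mod_less)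
  finally have i': "Suc i mod l = j'" .
  have "card (R\<^sup>* `` {x} \<inter> B i) \<ge> s" "card ((R\<inverse>)\<^sup>* `` {y} \<inter> B j') \<ge> s"
    using *[of "l * l + l - 1 + j' - j"] j' by (auto simp: i_def)
  then obtain S T where S: "S \<subseteq> R\<^sup>* `` {x} \<inter> B i" "card S = s"
    and T: "T \<subseteq> (R\<inverse>)\<^sup>* `` {y} \<inter> B j'" "card T = s"
    by (meson obtain_subset_with_card_n)
  then obtain a b where "a \<in> S" "b \<in> T" "(a, b) \<in> R"
    using ex[unfolded expanding_def, rule_format, OF i, of S T] i' by auto
  then have "(x, a) \<in> R\<^sup>*" "(a, b) \<in> R" "(b, y) \<in> R\<^sup>*" using S T by (auto simp: rtrancl_converse)
  then show ?thesis by (meson rtrancl.rtrancl_into_rtrancl rtrancl_trans)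
qed

text \<open>Makes the lemmas on spreading vertices available for backward reachability: the two sets
  change roles one layer earlier.\<close>

lemma expanding_converse:
  assumes "expanding R B (\<lambda>i. Suc i mod l) l s"
  shows "expanding (R\<inverse>) B (\<lambda>i. (i + l - 1) mod l) l s"
  unfolding expanding_def
proof (intro allI impI)
  fix i S T
  assume i: "i < l" and S: "S \<subseteq> B i" "T \<subseteq> B ((i + l - 1) mod l)" "card S = s" "card T = s"
  have "Suc ((i + l - 1) mod l) mod l = i" using i by (simp add: mod_Suc_eq)
  moreover have "(i + l - 1) mod l < l" using i by simp
  ultimately show "\<exists>x\<in>S. \<exists>y\<in>T. (x, y) \<in> R\<inverse>" 
    using assms[unfolded expanding_def, rule_format, of "(i + l - 1) mod l" T S] S by auto
qed

section \<open>The colored digraph between two thresholds\<close>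

declare One_nat_def [simp del]

text \<open>A value \<open>f e = (m, c)\<close> encodes the mark \<open>m\<close> and the color \<open>c\<close> of the arc \<open>e\<close>.\<close>

definition arcs0 :: "nat \<Rightarrow> (arc \<Rightarrow> nat \<times> nat) \<Rightarrow> arc set" where
  "arcs0 n f = {e \<in> all_arcs n. fst (f e) = 0}"

definition arcs1 :: "nat \<Rightarrow> (arc \<Rightarrow> nat \<times> nat) \<Rightarrow> arc set" where
  "arcs1 n f = {e \<in> all_arcs n. fst (f e) \<le> 1}"

text \<open>The vertices are cut, starting from 1, into consecutive intervals of length
  \<open>4 * s\<close>. The five zones take these in turn, so block index and zone are quotient and
  remainder of the interval number by 5.\<close>

definition blk :: "nat \<Rightarrow> nat \<Rightarrow> nat \<Rightarrow> nat set" where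
  "blk s k i = {(5 * i + k) * (4 * s) <.. (5 * i + k + 1) * (4 * s)}"

definition zone :: "nat \<Rightarrow> nat list \<Rightarrow> nat \<Rightarrow> nat set" where
  "zone s P k = (\<Union>i<length P. blk s k i)"

definition layered :: "nat \<Rightarrow> nat list \<Rightarrow> nat \<Rightarrow> nat \<Rightarrow> (arc \<Rightarrow> nat \<times> nat) \<Rightarrow> arc set" where
  "layered n P s k f = {(x, y). \<exists>i<length P. x \<in> blk s k i \<and> y \<in> blk s k (Suc i mod length P) \<and>
     (x, y) \<in> arcs0 n f \<and> snd (f (x, y)) = P ! i}"

definition core :: "nat \<Rightarrow> nat list \<Rightarrow> nat \<Rightarrow> nat \<Rightarrow> (arc \<Rightarrow> nat \<times> nat) \<Rightarrow> bool" where
  "core n P s k f = expanding (layered n P s k f) (blk s k) (\<lambda>i. Suc i mod length P) (length P) s"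

text \<open>The flag of \<open>orient\<close> lets one statement cover out-neighbors (\<open>True\<close>) and in-neighbors (\<open>False\<close>).\<close>

definition orient :: "bool \<Rightarrow> nat \<Rightarrow> nat \<Rightarrow> arc" where
  "orient d x y = (if d then (x, y) else (y, x))"

text \<open>The useful endpoints for an arc of color \<open>P ! i\<close> between a vertex outside
  the zone and the zone. Since arcs from block \<open>i\<close> to the next one carry
  \<open>P ! i\<close>, an entering arc of this color must end in block \<open>i + 1\<close> at a
  vertex that reaches much, and a leaving one must start in block \<open>i\<close> at a vertex that
  is reached by much.\<close>

definition target :: "bool \<Rightarrow> nat \<Rightarrow> nat list \<Rightarrow> nat \<Rightarrow> nat \<Rightarrow> (arc \<Rightarrow> nat \<times> nat) \<Rightarrow> nat \<Rightarrow> nat set" where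
  "target d n P s k f i =
     (if d then spreading (layered n P s k f) (blk s k) (length P) s \<inter> blk s k (Suc i mod length P)
      else spreading ((layered n P s k f)\<inverse>) (blk s k) (length P) s \<inter> blk s k i)"

definition stuck :: "bool \<Rightarrow> nat \<Rightarrow> nat list \<Rightarrow> nat set \<Rightarrow> (arc \<Rightarrow> nat \<times> nat) \<Rightarrow> nat \<Rightarrow> nat \<Rightarrow> bool" where
  "stuck d n P T f w i \<longleftrightarrow>
     (\<forall>x\<in>T. \<not> (orient d w x \<in> arcs0 n f \<and> snd (f (orient d w x)) = P ! i))"

abbreviation "dead d n P s k f w i \<equiv> stuck d n P (target d n P s k f i) f w i"

definition nbrs :: "bool \<Rightarrow> nat \<Rightarrow> (arc \<Rightarrow> nat \<times> nat) \<Rightarrow> nat \<Rightarrow> nat set" where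
  "nbrs d n f u = {x. orient d u x \<in> arcs0 n f}"

text \<open>The second conjunct serves vertices of small degree, whose only usable arc may have mark
  1; the third serves those of degree at least \<open>L\<close>. The fourth keeps the second and the
  penultimate vertex of the path apart when both ends have small degree. The last two place the
  hitting time of minimum degree one between the two thresholds.\<close>

definition typical :: "nat \<Rightarrow> nat list \<Rightarrow> nat \<Rightarrow> nat \<Rightarrow> nat \<Rightarrow> (arc \<Rightarrow> nat \<times> nat) \<Rightarrow> bool" where
  "typical n P s K L f \<longleftrightarrow>
     (\<forall>k<5. core n P s k f) \<and>
     (\<forall>d. \<forall>k<5. \<forall>i<length P. \<forall>u\<in>{1..n} - zone s P k. \<forall>w\<in>{1..n} - zone s P k.
        u \<noteq> w \<longrightarrow> card (nbrs d n f u) < L \<longrightarrow> orient d u w \<in> arcs1 n f \<longrightarrow> \<not> dead d n P s k f w i) \<and>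
     (\<forall>d. \<forall>k<5. \<forall>i<length P. \<forall>u\<in>{1..n} - zone s P k.
        card {w \<in> nbrs d n f u - zone s P k. dead d n P s k f w i} < K) \<and>
     (\<forall>u\<in>{1..n}. \<forall>v\<in>{1..n}. \<forall>w\<in>{1..n}. u \<noteq> v \<longrightarrow> u \<noteq> w \<longrightarrow> v \<noteq> w \<longrightarrow>
        card (nbrs True n f u) < L \<longrightarrow> card (nbrs False n f v) < L \<longrightarrow>
        (u, w) \<in> arcs1 n f \<longrightarrow> (w, v) \<notin> arcs1 n f) \<and>
     (\<exists>u\<in>{1..n}. nbrs True n f u = {}) \<and>
     (\<forall>d. \<forall>u\<in>{1..n}. \<exists>x. orient d u x \<in> arcs1 n f)"

section \<open>Walks and paths in the layered digraph\<close>

abbreviation dg :: "nat \<Rightarrow> arc set \<Rightarrow> (nat, arc) pre_digraph" where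
  "dg n F \<equiv> \<lparr>verts = {1..n}, arcs = F, tail = fst, head = snd\<rparr>"

lemma finite_all_arcs [simp]: "finite (all_arcs n)"
  by (rule finite_subset[of _ "{1..n} \<times> {1..n}"]) (auto simp: all_arcs_def)

lemma blk_div: "x \<in> blk s k i \<Longrightarrow> (x - 1) div (4 * s) = 5 * i + k"
  by (rule div_nat_eqI) (auto simp: blk_def algebra_simps)

lemma blk_inj:
  assumes "x \<in> blk s k i" "x \<in> blk s k' i'" "k < 5" "k' < 5"
  shows "i = i'" "k = k'"
proof -
  have *: "5 * i + k = 5 * i' + k'" using blk_div[OF assms(1)] blk_div[OF assms(2)] by simp
  then show "i = i'" "k = k'" using assms(3,4) by presburger+
qed

lemma finite_blk [simp]: "finite (blk s k i)" by (simp add: blk_def)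

lemma card_blk [simp]: "card (blk s k i) = 4 * s" by (simp add: blk_def algebra_simps)

lemma blk_subset_zone: "i < length P \<Longrightarrow> blk s k i \<subseteq> zone s P k" by (auto simp: zone_def)

lemma zone_inj: "x \<in> zone s P k \<Longrightarrow> x \<in> zone s P k' \<Longrightarrow> k < 5 \<Longrightarrow> k' < 5 \<Longrightarrow> k = k'"
  by (auto simp: zone_def dest: blk_inj)

lemma finite_zone [simp]: "finite (zone s P k)" by (simp add: zone_def)

lemma layered_subset: "layered n P s k f \<subseteq> arcs0 n f" by (auto simp: layered_def)

lemma arcs1_subset: "arcs1 n f \<subseteq> all_arcs n" by (auto simp: arcs1_def)

text \<open>Neither this notion nor the vertex list of a walk looks at the arc set, so a walk found
  in the layered digraph can be read in any larger one.\<close>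

lemma cas_dg: "pre_digraph.cas (dg n F) x p y = pre_digraph.cas (dg n F') x p y"
  by (induction p arbitrary: x) (simp_all add: pre_digraph.cas.simps)

lemma awalk_verts_dg: "pre_digraph.awalk_verts (dg n F) x p = pre_digraph.awalk_verts (dg n F') x p"
  by (induction p arbitrary: x) (simp_all add: pre_digraph.awalk_verts.simps)

lemma wf_digraph_dg: "F \<subseteq> all_arcs n \<Longrightarrow> wf_digraph (dg n F)"
  by unfold_locales (auto simp: all_arcs_def)

lemma rtrancl_imp_apath:
  assumes "(x, y) \<in> R\<^sup>*" "R \<subseteq> all_arcs n" "x \<in> {1..n}"
  shows "\<exists>p. pre_digraph.apath (dg n R) x p y"
proof -
  interpret wf_digraph "dg n R" using assms(2) by (rule wf_digraph_dg)
  have "\<exists>p. awalk x p y" using assms(1,3)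
  proof (induction rule: converse_rtrancl_induct)
    case base
    then have "awalk y [] y" by (simp add: awalk_Nil_iff)
    then show ?case ..
  next
    case (step a b)
    have "b \<in> {1..n}" using step.hyps(1) assms(2) by (auto simp: all_arcs_def)
    then obtain p where "awalk b p y" using step.IH by blast
    then have "awalk a ((a, b) # p) y" using step by (simp add: awalk_Cons_iff)
    then show ?case ..
  qed
  then show ?thesis using apath_awalk_to_apath by blast
qed

text \<open>Blocks are disjoint, so the block of a vertex fixes the color of every layered arc
  leaving it. Block index and pattern position thus advance together, by one per arc.\<close>

lemma layered_walk:
  assumes "set p \<subseteq> layered n P s k f" "pre_digraph.cas (dg n F) x p y" "x \<in> blk s k i" "i < length P" "k < 5"
  shows "(\<forall>j<length p. snd (f (p ! j)) = P ! ((i + j) mod length P)) \<and>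
    y \<in> blk s k ((i + length p) mod length P) \<and> set (pre_digraph.awalk_verts (dg n F) x p) \<subseteq> zone s P k"
  using assms(1-4)
proof (induction p arbitrary: x i)
  case Nil
  then show ?case using blk_subset_zone[of i P s k] by (auto simp: pre_digraph.cas.simps pre_digraph.awalk_verts.simps)
next
  case (Cons e p)
  obtain b where e: "e = (x, b)" and cas: "pre_digraph.cas (dg n F) b p y"
    using Cons.prems(2) by (cases e) (auto simp: pre_digraph.cas.simps)
  obtain i' where i': "i' < length P" "x \<in> blk s k i'" "b \<in> blk s k (Suc i' mod length P)" "snd (f (x, b)) = P ! i'"
    using Cons.prems(1) e by (auto simp: layered_def)
  have [simp]: "i' = i" using blk_inj(1)[OF i'(2) Cons.prems(3)] assms(5) by simp
  have "Suc i mod length P < length P" using i'(1) by (intro mod_less_divisor) linarith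
  from Cons.IH[OF _ cas _ this] i' Cons.prems(1)
  have IH: "(\<forall>j<length p. snd (f (p ! j)) = P ! ((Suc i mod length P + j) mod length P))"
    "y \<in> blk s k ((Suc i mod length P + length p) mod length P)"
    "set (pre_digraph.awalk_verts (dg n F) b p) \<subseteq> zone s P k" by auto
  have "snd (f ((e # p) ! j)) = P ! ((i + j) mod length P)" if "j < length (e # p)" for j
    using that IH(1) i'(4) Cons.prems(4) by (cases j) (auto simp: e mod_add_left_eq)
  moreover have "x \<in> zone s P k" using Cons.prems(3,4) blk_subset_zone by blast
  ultimately show ?case using IH(2,3) by (auto simp: e pre_digraph.awalk_verts.simps mod_add_left_eq)
qed

lemma apath_sandwich:
  assumes "pre_digraph.apath (dg n R) w' p z'" "R \<subseteq> F"
    and "set [(u, w), (w, w'), (z', z), (z, v)] \<subseteq> F" "F \<subseteq> all_arcs n"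
    and "distinct [u, w, z, v]" "{u, w, z, v} \<inter> set (pre_digraph.awalk_verts (dg n F) w' p) = {}"
  shows "pre_digraph.apath (dg n F) u ((u, w) # (w, w') # p @ [(z', z), (z, v)]) v"
proof -
  have ap: "w' \<in> {1..n}" "set p \<subseteq> R" "pre_digraph.cas (dg n F) w' p z'"
      "distinct (pre_digraph.awalk_verts (dg n F) w' p)"
    using assms(1) cas_dg[of n R w' p z' F] awalk_verts_dg[of n R w' p F]
    by (simp_all add: pre_digraph.apath_def pre_digraph.awalk_def)
  have 1: "pre_digraph.cas (dg n F) x p z' \<Longrightarrow> pre_digraph.cas (dg n F) x (p @ [(z', z), (z, v)]) v" for x
    by (induction p arbitrary: x) (auto simp: pre_digraph.cas.simps)
  have 2: "pre_digraph.cas (dg n F) x p z' \<Longrightarrow> pre_digraph.awalk_verts (dg n F) x (p @ [(z', z), (z, v)])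
     = pre_digraph.awalk_verts (dg n F) x p @ [z, v]" for x
    by (induction p arbitrary: x) (auto simp: pre_digraph.cas.simps pre_digraph.awalk_verts.simps)
  have "u \<in> {1..n}" using assms(3,4) by (auto simp: all_arcs_def)
  then show ?thesis using ap 1[of w'] 2[of w'] assms(2,3,5,6)
    by (auto simp: pre_digraph.apath_def pre_digraph.awalk_def pre_digraph.cas.simps pre_digraph.awalk_verts.simps)
qed

section \<open>Routing between two vertices through one zone\<close>

definition alive :: "bool \<Rightarrow> nat \<Rightarrow> nat list \<Rightarrow> nat \<Rightarrow> nat \<Rightarrow> (arc \<Rightarrow> nat \<times> nat) \<Rightarrow> nat set \<Rightarrow> nat set" where
  "alive d n P s k f W = {w\<in>W - zone s P k. \<forall>i<length P. \<not> dead d n P s k f w i}"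

lemma typicalD:
  assumes "typical n P s K L f"
  shows "\<forall>k<5. core n P s k f"
    and "\<forall>d. \<forall>k<5. \<forall>i<length P. \<forall>u\<in>{1..n} - zone s P k. \<forall>w\<in>{1..n} - zone s P k.
        u \<noteq> w \<longrightarrow> card (nbrs d n f u) < L \<longrightarrow> orient d u w \<in> arcs1 n f \<longrightarrow> \<not> dead d n P s k f w i"
    and "\<forall>d. \<forall>k<5. \<forall>i<length P. \<forall>u\<in>{1..n} - zone s P k.
        card {w \<in> nbrs d n f u - zone s P k. dead d n P s k f w i} < K"
    and "\<forall>u\<in>{1..n}. \<forall>v\<in>{1..n}. \<forall>w\<in>{1..n}. u \<noteq> v \<longrightarrow> u \<noteq> w \<longrightarrow> v \<noteq> w \<longrightarrow>
        card (nbrs True n f u) < L \<longrightarrow> card (nbrs False n f v) < L \<longrightarrow>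
        (u, w) \<in> arcs1 n f \<longrightarrow> (w, v) \<notin> arcs1 n f"
    and "\<exists>u\<in>{1..n}. nbrs True n f u = {}"
    and "\<forall>d. \<forall>u\<in>{1..n}. \<exists>x. orient d u x \<in> arcs1 n f"
  by (insert assms, unfold typical_def, elim conjE, assumption)+

lemma zone_unique: "\<exists>b. \<forall>k<5. k \<noteq> b \<longrightarrow> x \<notin> zone s P k"
proof (cases "\<exists>k<5. x \<in> zone s P k")
  case True
  then obtain b where "b < 5" "x \<in> zone s P b" by blast
  then show ?thesis using zone_inj[of x s P] by (intro exI[of _ b]) blast
qed blast

text \<open>At small degree a single arc of \<open>F\<close> is taken, and only the zone containing
  its other end is excluded. At large degree all neighbors along arcs of mark 0 are taken; two of
  them survive, so one can avoid a given vertex. Being alive concerns all positions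
  \<open>i\<close>, because the color of the arc at \<open>u\<close> decides which one will be
  needed.\<close>

lemma typical_candidates:
  assumes tp: "typical n P s K L f" and L: "L = 2 * (length P * K + 2)"
    and F: "F \<subseteq> arcs1 n f" and u: "u \<in> {1..n}" and ex: "\<exists>x. orient d u x \<in> F" and F0: "arcs0 n f \<subseteq> F"
  shows "\<exists>W b. (\<forall>w\<in>W. orient d u w \<in> F) \<and>
     (\<forall>k<5. k \<noteq> b \<longrightarrow> u \<notin> zone s P k \<longrightarrow>
        (card (nbrs d n f u) < L \<longrightarrow> alive d n P s k f W \<noteq> {}) \<and>
        (L \<le> card (nbrs d n f u) \<longrightarrow> card (alive d n P s k f W) \<ge> 2))"
proof (cases "card (nbrs d n f u) < L")
  case True
  obtain w where w: "orient d u w \<in> F" using ex by blast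
  then have w': "w \<in> {1..n}" "w \<noteq> u" using F arcs1_subset by (force simp: orient_def all_arcs_def split: if_splits)+
  obtain bad where bad: "\<forall>k<5. k \<noteq> bad \<longrightarrow> w \<notin> zone s P k" using zone_unique by blast
  have "\<not> dead d n P s k f w i" if "k < 5" "k \<noteq> bad" "u \<notin> zone s P k" "i < length P" for k i
  proof -
    have "u \<in> {1..n} - zone s P k" "w \<in> {1..n} - zone s P k" "u \<noteq> w" "orient d u w \<in> arcs1 n f"
      using that(1-3) bad u w w' F by auto
    then show ?thesis using typicalD(2)[OF tp, rule_format] that True by blast
  qed
  then have "w \<in> alive d n P s k f {w}" if "k < 5" "k \<noteq> bad" "u \<notin> zone s P k" for k
    using that bad unfolding alive_def by blast
  then have "alive d n P s k f {w} \<noteq> {}" if "k < 5" "k \<noteq> bad" "u \<notin> zone s P k" for k using that by blast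
  then show ?thesis using True w
    by (intro exI[of _ "{w}"] exI[of _ bad]) (simp add: not_le)
next
  case False
  let ?W = "nbrs d n f u"
  have fin: "finite ?W"
    by (rule finite_subset[of _ "{1..n}"]) (auto simp: nbrs_def orient_def arcs0_def all_arcs_def split: if_splits)
  \<comment> \<open>Zones are disjoint, so at most one of them contains more than half of the
    neighbors.\<close>
  have "\<exists>bad. \<forall>k<5. k \<noteq> bad \<longrightarrow> 2 * card (?W \<inter> zone s P k) \<le> card ?W"
  proof (rule ccontr)
    assume *: "\<not> ?thesis"
    then obtain k where k: "k < 5" "2 * card (?W \<inter> zone s P k) > card ?W" by (metis not_less)
    obtain k' where k': "k' < 5" "k' \<noteq> k" "2 * card (?W \<inter> zone s P k') > card ?W" using * by (metis not_less)
    have "(?W \<inter> zone s P k) \<inter> (?W \<inter> zone s P k') = {}" using zone_inj[OF _ _ k(1) k'(1)] k'(2) by auto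
    then have "card (?W \<inter> zone s P k) + card (?W \<inter> zone s P k') = card ((?W \<inter> zone s P k) \<union> (?W \<inter> zone s P k'))"
      using fin by (simp add: card_Un_disjoint)
    also have "\<dots> \<le> card ?W" using fin by (intro card_mono) auto
    finally show False using k(2) k'(3) by linarith
  qed
  then obtain bad where bad: "\<forall>k<5. k \<noteq> bad \<longrightarrow> 2 * card (?W \<inter> zone s P k) \<le> card ?W" by blast
  have "card (alive d n P s k f ?W) \<ge> 2"
    if k: "k < 5" "k \<noteq> bad" "u \<notin> zone s P k" for k
  proof -
    let ?V = "alive d n P s k f ?W"
    let ?B = "\<lambda>i. {w\<in>?W - zone s P k. dead d n P s k f w i}"
    \<comment> \<open>\<open>L\<close> is chosen for this count: at least
      \<open>L / 2 = length P * K + 2\<close> neighbors lie outside the zone, and at most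
      \<open>length P * K\<close> of these are dead for some position.\<close>
    have "card (\<Union>i<length P. ?B i) \<le> (\<Sum>i<length P. card (?B i))" by (rule card_UN_le) simp
    also have "\<dots> \<le> (\<Sum>i<length P. K)"
      using typicalD(3)[OF tp, rule_format] k u by (intro sum_mono less_imp_le) blast
    finally have B: "card (\<Union>i<length P. ?B i) \<le> length P * K" by simp
    have "card (?W - zone s P k) \<le> card (?V \<union> (\<Union>i<length P. ?B i))"
      using fin by (intro card_mono) (auto simp: alive_def)
    also have "\<dots> \<le> card ?V + card (\<Union>i<length P. ?B i)" by (rule card_Un_le)
    finally have "card (?W - zone s P k) \<le> card ?V + length P * K" using B by linarith
    moreover have "card (?W \<inter> zone s P k) + card (?W - zone s P k) = card ?W" using card_Int_Diff[OF fin] by metis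
    moreover have "2 * card (?W \<inter> zone s P k) \<le> card ?W" using bad k by blast
    moreover have "4 + 2 * (length P * K) \<le> card ?W" using False L by simp
    ultimately show ?thesis by linarith
  qed
  moreover have "\<forall>w\<in>?W. orient d u w \<in> F" using F0 by (auto simp: nbrs_def)
  ultimately show ?thesis using False by (intro exI[of _ ?W] exI[of _ bad]) blast
qed

text \<open>\<open>F\<close> stands for the arcs present at the hitting time of minimum degree one.
  Layered arcs and the arcs attaching \<open>w\<close> and \<open>z\<close> to the zone have mark 0
  and hence lie in \<open>F\<close>; the first and the last arc of the path may have mark 1.\<close>

lemma typical_connected:
  assumes tp: "typical n P s K L f" and L: "L = 2 * (length P * K + 2)" and s: "s > 0"
    and F0: "arcs0 n f \<subseteq> F" and F1: "F \<subseteq> arcs1 n f"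
    and deg: "\<And>d u. u \<in> {1..n} \<Longrightarrow> \<exists>x. orient d u x \<in> F"
    and col: "\<And>e. e \<in> F \<Longrightarrow> snd (f e) \<in> set P"
  shows "pattern_connected P (dg n F) (\<lambda>e. snd (f e))"
  unfolding pattern_connected_def
proof (intro ballI impI)
  fix u v assume "u \<in> verts (dg n F)" "v \<in> verts (dg n F)" and uv: "u \<noteq> v"
  then have u: "u \<in> {1..n}" and v: "v \<in> {1..n}" by simp_all
  let ?l = "length P"
  have Fall: "F \<subseteq> all_arcs n" using F1 arcs1_subset by blast
  interpret wf_digraph "dg n F" using Fall by (rule wf_digraph_dg)
  have lpos: "?l > 0" using deg[OF u] col by (metis emptyE length_greater_0_conv list.set(1))
  obtain W bw where W: "\<forall>w\<in>W. orient True u w \<in> F" and bw0: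
      "\<forall>k<5. k \<noteq> bw \<longrightarrow> u \<notin> zone s P k \<longrightarrow>
        (card (nbrs True n f u) < L \<longrightarrow> alive True n P s k f W \<noteq> {}) \<and>
        (L \<le> card (nbrs True n f u) \<longrightarrow> card (alive True n P s k f W) \<ge> 2)"
    using typical_candidates[OF tp L F1 u deg[OF u] F0, of True] by blast
  obtain Z bz where Z: "\<forall>z\<in>Z. orient False v z \<in> F" and bz0:
      "\<forall>k<5. k \<noteq> bz \<longrightarrow> v \<notin> zone s P k \<longrightarrow>
        (card (nbrs False n f v) < L \<longrightarrow> alive False n P s k f Z \<noteq> {}) \<and>
        (L \<le> card (nbrs False n f v) \<longrightarrow> card (alive False n P s k f Z) \<ge> 2)"
    using typical_candidates[OF tp L F1 v deg[OF v] F0, of False] by blast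
  show "\<exists>p. apath u p v \<and> pattern_colored P (\<lambda>e. snd (f e)) p"
  \<comment> \<open>A single arc is pattern colored because its color occurs in \<open>P\<close>.
    Splitting this case off ensures below that \<open>w \<noteq> v\<close> and
    \<open>z \<noteq> u\<close>.\<close>
  proof (cases "(u, v) \<in> F")
    case True
    have "apath u [(u, v)] v" using True u v uv by (simp add: apath_Cons_iff apath_Nil_iff)
    moreover obtain a where "a < ?l" "P ! a = snd (f (u, v))" using col[OF True] by (metis in_set_conv_nth)
    then have "pattern_colored P (\<lambda>e. snd (f e)) [(u, v)]"
      unfolding pattern_colored_def by (intro exI[of _ a]) auto
    ultimately show ?thesis by blast
  next
    case False
    obtain bu where bu: "\<forall>k<5. k \<noteq> bu \<longrightarrow> u \<notin> zone s P k" using zone_unique by blast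
    obtain bv where bv: "\<forall>k<5. k \<noteq> bv \<longrightarrow> v \<notin> zone s P k" using zone_unique by blast
    \<comment> \<open>At most four zones are excluded: those containing \<open>u\<close> or
      \<open>v\<close> and the exceptional ones of the two candidate sets. One of the five
      remains.\<close>
    have "{..<5} - {bu, bv, bw, bz} \<noteq> ({} :: nat set)"
    proof
      assume "{..<5} - {bu, bv, bw, bz} = ({} :: nat set)"
      then have "{..<5} \<subseteq> {bu, bv, bw, bz}" by auto
      then have "card {..<5::nat} \<le> card {bu, bv, bw, bz}" by (intro card_mono) auto
      also have "\<dots> \<le> 4" by (simp add: card_insert_if)
      finally show False by simp
    qed
    then obtain k where k: "k < 5" "k \<noteq> bu" "k \<noteq> bv" "k \<noteq> bw" "k \<noteq> bz" by auto
    have uk: "u \<notin> zone s P k" and vk: "v \<notin> zone s P k" using bu bv k by auto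
    let ?W = "alive True n P s k f W" and ?Z = "alive False n P s k f Z"
    have bw: "card (nbrs True n f u) < L \<Longrightarrow> ?W \<noteq> {}" "L \<le> card (nbrs True n f u) \<Longrightarrow> card ?W \<ge> 2"
      using bw0 k uk by blast+
    have bz: "card (nbrs False n f v) < L \<Longrightarrow> ?Z \<noteq> {}" "L \<le> card (nbrs False n f v) \<Longrightarrow> card ?Z \<ge> 2"
      using bz0 k vk by blast+
    have W': "(u, w) \<in> F" if "w \<in> ?W" for w using W that unfolding alive_def orient_def by auto
    have Z': "(z, v) \<in> F" if "z \<in> ?Z" for z using Z that unfolding alive_def orient_def by auto
    have two: "\<exists>x\<in>X. x \<noteq> y" if "card X \<ge> 2" for X :: "nat set" and y
    proof (rule ccontr)
      assume "\<not> ?thesis"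
      then have "X \<subseteq> {y}" by auto
      then have "card X \<le> card {y}" by (intro card_mono) auto
      then show False using that by simp
    qed
    \<comment> \<open>If both degrees are small, the fourth conjunct of \<open>typical\<close>
      forbids a common vertex. Otherwise one side offers two candidates, one of which differs from
      the choice on the other side.\<close>
    have "\<exists>w\<in>?W. \<exists>z\<in>?Z. w \<noteq> z"
    proof -
      consider "card (nbrs True n f u) < L" "card (nbrs False n f v) < L" | "L \<le> card (nbrs True n f u)"
        | "L \<le> card (nbrs False n f v)" by linarith
      then show ?thesis
      proof cases
        case 1
        then obtain w z where wz: "w \<in> ?W" "z \<in> ?Z" using bw(1) bz(1) by blast
        have uw: "(u, w) \<in> F" and zv: "(z, v) \<in> F" using W' Z' wz by auto
        have "w \<noteq> z"
        proof
          assume "w = z"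
          then have "(u, w) \<in> arcs1 n f" "(w, v) \<in> arcs1 n f" using uw zv F1 by auto
          moreover have "w \<in> {1..n}" "u \<noteq> w" "v \<noteq> w" using uw zv Fall \<open>w = z\<close> by (auto simp: all_arcs_def)
          ultimately show False using typicalD(4)[OF tp, rule_format] 1 u v uv by blast
        qed
        then show ?thesis using wz by blast
      next
        case 2
        have "?Z \<noteq> {}" using bz by (cases "card (nbrs False n f v) < L") (auto simp: not_less)
        then obtain z where z: "z \<in> ?Z" by blast
        show ?thesis using two[OF bw(2)[OF 2], of z] z by blast
      next
        case 3
        have "?W \<noteq> {}" using bw by (cases "card (nbrs True n f u) < L") (auto simp: not_less)
        then obtain w where w: "w \<in> ?W" by blast
        obtain z where z: "z \<in> ?Z" "z \<noteq> w" using two[OF bz(2)[OF 3], of w] by blast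
        from z(2) have "w \<noteq> z" by (rule not_sym)
        then show ?thesis using w z(1) by blast
      qed
    qed
    then obtain w z where wW: "w \<in> ?W" and zZ: "z \<in> ?Z" and wz: "w \<noteq> z" by blast
    have w: "w \<notin> zone s P k" "\<And>i. i < ?l \<Longrightarrow> \<not> dead True n P s k f w i" using wW by (simp_all add: alive_def)
    have z: "z \<notin> zone s P k" "\<And>i. i < ?l \<Longrightarrow> \<not> dead False n P s k f z i" using zZ by (simp_all add: alive_def)
    have uw: "(u, w) \<in> F" and zv: "(z, v) \<in> F" using W'[OF wW] Z'[OF zZ] by auto
    obtain a where a: "a < ?l" "P ! a = snd (f (u, w))" using col[OF uw] by (metis in_set_conv_nth)
    obtain b where b: "b < ?l" "P ! b = snd (f (z, v))" using col[OF zv] by (metis in_set_conv_nth)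
    \<comment> \<open>The pattern position \<open>a\<close> belongs to the arc from \<open>u\<close>
      to \<open>w\<close>, and \<open>b\<close> to the arc from \<open>z\<close> to
      \<open>v\<close>. The arc entering the zone must have the position after \<open>a\<close>, the
      arc leaving it the position before \<open>b\<close>.\<close>
    let ?i = "Suc a mod ?l" and ?j = "(b + ?l - 1) mod ?l"
    have ij: "?i < ?l" "?j < ?l" "Suc ?i mod ?l < ?l" using lpos by simp_all
    have "Suc (b + ?l - 1) = b + ?l" using lpos by simp
    then have jb: "Suc ?j mod ?l = b" using b(1) by (simp only: mod_Suc_eq) simp
    let ?R = "layered n P s k f"
    obtain w' where w': "w' \<in> spreading ?R (blk s k) ?l s" "w' \<in> blk s k (Suc ?i mod ?l)"
      "(w, w') \<in> arcs0 n f" "snd (f (w, w')) = P ! ?i"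
      using w(2)[OF ij(1)] unfolding stuck_def target_def orient_def by auto
    obtain z' where z': "z' \<in> spreading (?R\<inverse>) (blk s k) ?l s" "z' \<in> blk s k ?j"
      "(z', z) \<in> arcs0 n f" "snd (f (z', z)) = P ! ?j"
      using z(2)[OF ij(2)] unfolding stuck_def target_def orient_def by auto
    have "core n P s k f" using typicalD(1)[OF tp] k(1) by blast
    then have "(w', z') \<in> ?R\<^sup>*"
      unfolding core_def by (rule expanding_link) (use s w' z' in auto)
    moreover have RF: "?R \<subseteq> F" using layered_subset F0 by blast
    moreover have "w' \<in> {1..n}" using w'(3) F0 Fall by (auto simp: all_arcs_def)
    ultimately obtain p where p: "pre_digraph.apath (dg n ?R) w' p z'"
      using rtrancl_imp_apath[of w' z' ?R n] Fall by blast
    then have p': "set p \<subseteq> ?R" "pre_digraph.cas (dg n F) w' p z'"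
      using cas_dg[of n ?R w' p z' F] by (auto simp: pre_digraph.apath_def pre_digraph.awalk_def)
    note lw = layered_walk[OF p' w'(2) ij(3) k(1)]
    \<comment> \<open>The length of \<open>p\<close> is not prescribed, but \<open>p\<close> ends in
      the block of \<open>z'\<close>, and disjointness of the blocks forces the pattern position
      there to be the wanted \<open>?j\<close>.\<close>
    have last: "(Suc ?i mod ?l + length p) mod ?l = ?j"
      using lw z'(2) blk_inj(1)[OF _ z'(2) k(1) k(1)] by blast
    let ?p = "(u, w) # (w, w') # p @ [(z', z), (z, v)]"
    have "apath u ?p v"
    proof (rule apath_sandwich[OF p RF _ Fall])
      show "set [(u, w), (w, w'), (z', z), (z, v)] \<subseteq> F" using uw zv w'(3) z'(3) F0 by auto
      have "w \<noteq> v" "z \<noteq> u" using False uw zv by auto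
      then show "distinct [u, w, z, v]" using uw zv Fall uv wz by (auto simp: all_arcs_def)
      show "{u, w, z, v} \<inter> set (awalk_verts w' p) = {}" using lw uk vk w(1) z(1) by blast
    qed
    moreover have "pattern_colored P (\<lambda>e. snd (f e)) ?p"
      unfolding pattern_colored_def
    proof (intro exI[of _ a] conjI allI impI)
      fix j assume j: "j < length ?p"
      have m: "(a + Suc (Suc m)) mod ?l = (Suc ?i mod ?l + m) mod ?l" for m
        by (metis add_Suc_right add_Suc mod_Suc_eq mod_add_left_eq)
      consider "j = 0" | "j = 1" | m where "j = Suc (Suc m)" "m < length p" | "j = Suc (Suc (length p))"
        | "j = Suc (Suc (Suc (length p)))"
        using j by (cases j; cases "j - 1") (fastforce simp: less_Suc_eq)+
      then show "snd (f (?p ! j)) = P ! ((j + a) mod ?l)"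
      proof cases
        case 1 then show ?thesis using a by simp
      next
        case 2 then show ?thesis using w'(4) by (simp add: One_nat_def)
      next
        case (3 m)
        then show ?thesis using lw m[of m] by (simp add: nth_append add.commute)
      next
        case 4
        then show ?thesis using z'(4) m[of "length p"] last by (simp add: nth_append add.commute)
      next
        case 5
        have "(j + a) mod ?l = Suc ((a + Suc (Suc (length p))) mod ?l) mod ?l" using 5 by (simp add: mod_Suc_eq add.commute)
        also have "\<dots> = b" using m[of "length p"] last jb by simp
        finally show ?thesis using 5 b by (simp add: nth_append)
      qed
    qed (use a in simp)
    ultimately show ?thesis by blast
  qed
qed

section \<open>From the process to independent marks\<close>

definition histories :: "nat \<Rightarrow> nat \<Rightarrow> nat \<Rightarrow> (arc \<times> nat) list set" where
  "histories r n i = {h. length h = i \<and> distinct (map fst h) \<and> fst ` set h \<subseteq> all_arcs n \<and> snd ` set h \<subseteq> {1..r}}"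

lemma card_all_arcs: "card (all_arcs n) = n * (n - 1)"
proof -
  have "all_arcs n = (SIGMA u:{1..n}. {1..n} - {u})" by (auto simp: all_arcs_def)
  then show ?thesis by (simp add: card_SigmaI)
qed

lemma finite_histories [simp]: "finite (histories r n i)"
proof (rule finite_subset)
  show "histories r n i \<subseteq> {h. set h \<subseteq> all_arcs n \<times> {1..r} \<and> length h = i}"
    by (force simp: histories_def)
  show "finite {h. set h \<subseteq> all_arcs n \<times> {1..r} \<and> length h = i}"
    by (intro finite_lists_length_eq) auto
qed

lemma pmf_of_set_eqI:
  assumes fin: "finite S" and sub: "set_pmf p \<subseteq> S" and const: "\<And>x. x \<in> S \<Longrightarrow> pmf p x = c"
  shows "p = pmf_of_set S"
proof -
  have ne: "S \<noteq> {}" using sub set_pmf_not_empty[of p] by auto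
  have "(\<Sum>x\<in>S. pmf p x) = 1" using sum_pmf_eq_1[OF fin sub] .
  then have "c * card S = 1" using const by (simp add: mult.commute)
  then have c: "c = 1 / card S" using ne fin by (simp add: field_simps)
  show ?thesis
  proof (rule pmf_eqI)
    fix x
    show "pmf p x = pmf (pmf_of_set S) x"
    proof (cases "x \<in> S")
      case False
      then have "pmf p x = 0" using sub by (auto simp: set_pmf_eq)
      then show ?thesis using False ne fin by simp
    qed (use const c ne fin in simp)
  qed
qed

text \<open>A history of \<open>i + 1\<close> steps has a unique last entry and a unique
  predecessor, and the probability of that last step, one over the number \<open>m\<close> of free
  arcs times \<open>r\<close>, is the same for all predecessors.\<close>

lemma colored_process_uniform:
  assumes r: "r \<ge> 1" and "i \<le> n * (n - 1)"
  shows "histories r n i \<noteq> {} \<and> colored_process r n i = pmf_of_set (histories r n i)"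
  using assms(2)
proof (induction i)
  case 0
  have "histories r n 0 = {[]}" by (auto simp: histories_def)
  then show ?case by (simp add: pmf_of_set_singleton)
next
  case (Suc i)
  let ?H = "histories r n i" and ?A = "all_arcs n"
  define m where "m = n * (n - 1) - i"
  have m: "m > 0" using Suc.prems by (simp add: m_def)
  have ne: "?H \<noteq> {}" and IH: "colored_process r n i = pmf_of_set ?H" using Suc by auto
  have cardR: "card (?A - fst ` set h) = m" if "h \<in> ?H" for h
  proof -
    have "card (set (map fst h)) = length (map fst h)"
      by (rule distinct_card) (use that in \<open>simp add: histories_def\<close>)
    then have "card (fst ` set h) = i" using that by (simp add: histories_def)
    then show ?thesis using that by (subst card_Diff_subset) (auto simp: histories_def card_all_arcs m_def)
  qed
  have neR: "?A - fst ` set h \<noteq> {}" if "h \<in> ?H" for h using cardR[OF that] m by (metis card.empty less_irrefl)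
  have sub: "set_pmf (colored_process r n (Suc i)) \<subseteq> histories r n (Suc i)"
  proof -
    have "h @ [(e, c)] \<in> histories r n (Suc i)"
      if "h \<in> ?H" "e \<in> ?A - fst ` set h" "c \<in> {1..r}" for h e c
      using that unfolding histories_def by auto
    then show ?thesis using r ne neR by (auto simp: IH set_pmf_of_set)
  qed
  have "pmf (colored_process r n (Suc i)) x = 1 / (card ?H * m * r)" if x: "x \<in> histories r n (Suc i)" for x
  proof -
    obtain h e c where xe: "x = h @ [(e, c)]" using x by (cases x rule: rev_cases) (auto simp: histories_def)
    have h: "h \<in> ?H" "e \<in> ?A - fst ` set h" "c \<in> {1..r}" using x by (auto simp: xe histories_def)
    let ?F = "\<lambda>h'. pmf (pmf_of_set (?A - fst ` set h') \<bind> (\<lambda>e. pmf_of_set {1..r} \<bind> (\<lambda>c. return_pmf (h' @ [(e, c)])))) x"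
    have F: "?F h' = (if h' = h then 1 / (m * r) else 0)" if h': "h' \<in> ?H" for h'
    proof -
      have "?F h' = (\<Sum>e'\<in>?A - fst ` set h'. (\<Sum>c'\<in>{1..r}. if h' = h \<and> e' = e \<and> c' = c then 1 else 0) / r) / m"
      proof -
        have inner: "pmf (pmf_of_set {1..r} \<bind> (\<lambda>c. return_pmf (h' @ [(e', c)]))) x =
            (\<Sum>c'\<in>{1..r}. if h' = h \<and> e' = e \<and> c' = c then 1 else 0) / r" for e'
        proof -
          have "pmf (pmf_of_set {1..r} \<bind> (\<lambda>c. return_pmf (h' @ [(e', c)]))) x =
              (\<Sum>c'\<in>{1..r}. pmf (return_pmf (h' @ [(e', c')])) x) / card {1..r}"
            by (rule pmf_bind_pmf_of_set) (use r in auto)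
          also have "\<dots> = (\<Sum>c'\<in>{1..r}. if h' = h \<and> e' = e \<and> c' = c then 1 else 0) / r"
            by (intro arg_cong2[where f = "(/)"] sum.cong) (auto simp: xe indicator_def)
          finally show ?thesis .
        qed
        show ?thesis using neR[OF h'] by (subst pmf_bind_pmf_of_set) (simp_all add: inner cardR[OF h'])
      qed
      also have "\<dots> = (\<Sum>e'\<in>?A - fst ` set h'. (if h' = h \<and> e' = e then 1 / r else 0)) / m"
        using h(3) by (intro arg_cong2[where f = "(/)"] sum.cong refl) (auto simp: sum.delta)
      also have "\<dots> = (if h' = h then 1 / (m * r) else 0)"
        using h(2) by (auto simp: sum.delta)
      finally show ?thesis .
    qed
    have "pmf (colored_process r n (Suc i)) x = (\<Sum>h'\<in>?H. ?F h') / card ?H"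
      using ne by (simp add: IH pmf_bind_pmf_of_set)
    also have "(\<Sum>h'\<in>?H. ?F h') = (\<Sum>h'\<in>?H. if h' = h then 1 / (m * r) else 0)"
      by (intro sum.cong refl F)
    also have "\<dots> = 1 / (m * r)" using h(1) by simp
    finally show ?thesis by simp
  qed
  from pmf_of_set_eqI[OF finite_histories sub this] 
  show ?case using sub set_pmf_not_empty[of "colored_process r n (Suc i)"] by blast
qed

section \<open>Independent marks and the arc orders compatible with them\<close>

definition omega :: "nat \<Rightarrow> nat \<Rightarrow> nat pmf \<Rightarrow> (arc \<Rightarrow> nat \<times> nat) pmf" where
  "omega r n M = Pi_pmf (all_arcs n) (0, 0) (\<lambda>_. pair_pmf M (pmf_of_set {1..r}))"

definition orders :: "nat \<Rightarrow> (arc \<Rightarrow> nat \<times> nat) \<Rightarrow> arc list set" where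
  "orders n f = {es \<in> permutations_of_set (all_arcs n). sorted (map (\<lambda>e. fst (f e)) es)}"

definition label :: "(arc \<Rightarrow> nat \<times> nat) \<Rightarrow> arc list \<Rightarrow> (arc \<times> nat) list" where
  "label f es = map (\<lambda>e. (e, snd (f e))) es"

text \<open>A coupling: the first marginal is the product space \<open>omega\<close>, while the
  second will be identified with the process. Ties between equal marks are broken uniformly.\<close>

definition joint :: "nat \<Rightarrow> nat \<Rightarrow> nat pmf \<Rightarrow> ((arc \<Rightarrow> nat \<times> nat) \<times> (arc \<times> nat) list) pmf" where
  "joint r n M = bind_pmf (omega r n M) (\<lambda>f. map_pmf (\<lambda>es. (f, label f es)) (pmf_of_set (orders n f)))"

lemma finite_orders [simp]: "finite (orders n f)" by (simp add: orders_def)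

lemma orders_nonempty [simp]: "orders n f \<noteq> {}"
proof -
  obtain xs where xs: "set xs = all_arcs n" "distinct xs" using finite_distinct_list[OF finite_all_arcs] by blast
  then have "sort_key (\<lambda>e. fst (f e)) xs \<in> orders n f"
    by (auto simp: orders_def permutations_of_set_def)
  then show ?thesis by blast
qed

lemma set_omega:
  assumes "r \<ge> 1" "f \<in> set_pmf (omega r n M)" "e \<in> all_arcs n"
  shows "snd (f e) \<in> {1..r}"
proof -
  have "f \<in> PiE_dflt (all_arcs n) (0, 0) (\<lambda>_. set_pmf M \<times> {1..r})"
    using assms(1,2) by (auto simp: omega_def set_Pi_pmf set_pair_pmf set_pmf_of_set)
  then have "f e \<in> set_pmf M \<times> {1..r}" using assms(3) by (cases e) (auto simp: PiE_dflt_def)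
  then show ?thesis by auto
qed

text \<open>All arcs have the same law, so they may be permuted; colors are uniform and independent
  of the marks, so they may be permuted too, by a permutation that depends on the arc.\<close>

lemma omega_invariant:
  assumes \<sigma>: "\<sigma> permutes all_arcs n" and \<tau>: "\<And>e. \<tau> e permutes {1..r}" and r: "r \<ge> 1"
  shows "map_pmf (\<lambda>f e. if e \<in> all_arcs n then apsnd (\<tau> e) (f (\<sigma> e)) else (0, 0)) (omega r n M) = omega r n M"
proof -
  let ?A = "all_arcs n" and ?q = "pair_pmf M (pmf_of_set {1..r})"
  have q: "map_pmf (apsnd (\<tau> e)) ?q = ?q" for e
  proof -
    have "map_pmf (\<tau> e) (pmf_of_set {1..r}) = pmf_of_set {1..r}"
      by (rule map_pmf_of_set_bij_betw) (use r permutes_imp_bij[OF \<tau>] in auto)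
    moreover have "map_pmf (apsnd (\<tau> e)) ?q = pair_pmf M (map_pmf (\<tau> e) (pmf_of_set {1..r}))"
      by (simp add: pair_map_pmf2 apsnd_def map_prod_def)
    ultimately show ?thesis by simp
  qed
  have "omega r n M = map_pmf (\<lambda>g. g \<circ> \<sigma>) (omega r n M)"
    unfolding omega_def
    by (rule Pi_pmf_bij_betw) (use permutes_imp_bij[OF \<sigma>] permutes_not_in[OF \<sigma>] in auto)
  then have "map_pmf (\<lambda>f e. if e \<in> ?A then apsnd (\<tau> e) (f e) else (0, 0)) (omega r n M) =
     map_pmf (\<lambda>f e. if e \<in> ?A then apsnd (\<tau> e) (f e) else (0, 0)) (map_pmf (\<lambda>g. g \<circ> \<sigma>) (omega r n M))" by simp
  also have "\<dots> = map_pmf (\<lambda>f e. if e \<in> ?A then apsnd (\<tau> e) (f (\<sigma> e)) else (0, 0)) (omega r n M)"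
    by (simp add: pmf.map_comp o_def cong: if_cong)
  finally have *: "map_pmf (\<lambda>f e. if e \<in> ?A then apsnd (\<tau> e) (f (\<sigma> e)) else (0, 0)) (omega r n M) =
    map_pmf (\<lambda>f e. if e \<in> ?A then apsnd (\<tau> e) (f e) else (0, 0)) (omega r n M)" by simp
  have "Pi_pmf ?A (0, 0) (\<lambda>e. ?q \<bind> (\<lambda>y. return_pmf (apsnd (\<tau> e) y))) =
     Pi_pmf ?A (0, 0) (\<lambda>_. ?q) \<bind> (\<lambda>f. Pi_pmf ?A (0, 0) (\<lambda>e. return_pmf (apsnd (\<tau> e) (f e))))"
    by (rule Pi_pmf_bind) simp
  then have "map_pmf (\<lambda>f e. if e \<in> ?A then apsnd (\<tau> e) (f e) else (0, 0)) (omega r n M) = omega r n M"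
    using q by (simp add: omega_def map_pmf_def)
  with * show ?thesis by simp
qed

text \<open>Relabelling a history by \<open>\<Psi>\<close> is matched by a transformation
  \<open>\<Phi>\<close> of marks and colors that preserves \<open>omega\<close> and carries
  compatible orders to compatible orders.\<close>

lemma joint_invariant:
  assumes \<sigma>: "\<sigma> permutes all_arcs n" and \<tau>: "\<And>e. \<tau> e permutes {1..r}" and r: "r \<ge> 1"
  defines "\<Psi> \<equiv> map (\<lambda>(e, c). (\<sigma> e, \<tau> e c))"
  shows "map_pmf \<Psi> (map_pmf snd (joint r n M)) = map_pmf snd (joint r n M)"
proof -
  let ?A = "all_arcs n"
  define \<sigma>i where "\<sigma>i = inv \<sigma>"
  have \<sigma>i: "\<sigma>i permutes ?A" using \<sigma> by (simp add: \<sigma>i_def permutes_inv)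
  have inv: "\<sigma>i (\<sigma> e) = e" "\<sigma> (\<sigma>i e) = e" for e
    using permutes_inverses[OF \<sigma>] by (simp_all add: \<sigma>i_def)
  have inA: "\<sigma> e \<in> ?A \<longleftrightarrow> e \<in> ?A" "\<sigma>i e \<in> ?A \<longleftrightarrow> e \<in> ?A" for e
    using permutes_in_image[OF \<sigma>] permutes_in_image[OF \<sigma>i] by auto
  \<comment> \<open>An assignment is moved along \<open>\<sigma>\<close> by composing with the
    inverse of \<open>\<sigma>\<close>.\<close>
  define \<Phi> where "\<Phi> = (\<lambda>f e. if e \<in> ?A then apsnd (\<tau> (\<sigma>i e)) (f (\<sigma>i e)) else (0 :: nat, 0 :: nat))"
  have \<Phi>: "map_pmf \<Phi> (omega r n M) = omega r n M"
    unfolding \<Phi>_def by (rule omega_invariant[OF \<sigma>i \<tau> r])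
  have ord: "orders n (\<Phi> f) = map \<sigma> ` orders n f" for f
  proof (intro equalityI subsetI)
    fix es assume "es \<in> orders n (\<Phi> f)"
    then have es: "set es = ?A" "distinct es" "sorted (map (\<lambda>e. fst (\<Phi> f e)) es)"
      by (auto simp: orders_def permutations_of_set_def)
    have "map (\<lambda>e. fst (\<Phi> f e)) es = map (\<lambda>e. fst (f e)) (map \<sigma>i es)"
      using es(1) by (auto simp: \<Phi>_def)
    then have "sorted (map (\<lambda>e. fst (f e)) (map \<sigma>i es))" using es(3) by (simp only:)
    moreover have "map \<sigma>i es \<in> permutations_of_set ?A"
      using es(1,2) \<sigma>i by (auto simp: permutations_of_set_def distinct_map permutes_image permutes_inj_on)
    ultimately have "map \<sigma>i es \<in> orders n f" by (simp only: orders_def mem_Collect_eq)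
    moreover have "es = map \<sigma> (map \<sigma>i es)" by (simp add: inv o_def)
    ultimately show "es \<in> map \<sigma> ` orders n f" by blast
  next
    fix es assume "es \<in> map \<sigma> ` orders n f"
    then obtain es' where e': "es = map \<sigma> es'" "set es' = ?A" "distinct es'" "sorted (map (\<lambda>e. fst (f e)) es')"
      by (auto simp: orders_def permutations_of_set_def)
    have "map (\<lambda>e. fst (\<Phi> f e)) es = map (\<lambda>e. fst (f e)) es'"
      using e'(1,2) inA by (auto simp: \<Phi>_def inv)
    moreover have "es \<in> permutations_of_set ?A"
      using e' \<sigma> by (auto simp: permutations_of_set_def distinct_map permutes_image permutes_inj_on)
    ultimately show "es \<in> orders n (\<Phi> f)" using e'(4) by (simp add: orders_def)
  qed
  have inj: "inj (map \<sigma>)" using permutes_inj[OF \<sigma>] by (simp add: inj_map_eq_map inj_on_def)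
  have lab: "label (\<Phi> f) (map \<sigma> es) = \<Psi> (label f es)" if "es \<in> orders n f" for f es
    using that inA by (auto simp: label_def \<Psi>_def \<Phi>_def inv orders_def permutations_of_set_def apsnd_def)
  have "map_pmf (label (\<Phi> f)) (pmf_of_set (orders n (\<Phi> f))) =
      map_pmf \<Psi> (map_pmf (label f) (pmf_of_set (orders n f)))" for f
  proof -
    have "pmf_of_set (orders n (\<Phi> f)) = map_pmf (map \<sigma>) (pmf_of_set (orders n f))"
      unfolding ord by (rule map_pmf_of_set_inj[symmetric]) (use inj in \<open>auto intro: inj_on_subset\<close>)
    then show ?thesis by (auto simp: pmf.map_comp o_def lab intro!: map_pmf_cong)
  qed
  note eq = this
  have snd_joint: "map_pmf snd (joint r n M) = omega r n M \<bind> (\<lambda>f. map_pmf (label f) (pmf_of_set (orders n f)))"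
    by (simp add: joint_def map_bind_pmf pmf.map_comp o_def)
  have "map_pmf snd (joint r n M) = map_pmf \<Phi> (omega r n M) \<bind> (\<lambda>f. map_pmf (label f) (pmf_of_set (orders n f)))"
    unfolding snd_joint \<Phi> ..
  also have "\<dots> = omega r n M \<bind> (\<lambda>f. map_pmf \<Psi> (map_pmf (label f) (pmf_of_set (orders n f))))"
    by (simp only: bind_map_pmf eq)
  also have "\<dots> = map_pmf \<Psi> (map_pmf snd (joint r n M))"
    unfolding snd_joint by (simp add: map_bind_pmf)
  finally show ?thesis by simp
qed

text \<open>Relabelling arcs and colors preserves the law of the second component of \<open>joint\<close> and acts transitively
  on complete histories, so that law is uniform, as is that of the process.\<close>

lemma histories_transitive:
  assumes h: "h \<in> histories r n (n * (n - 1))" and h': "h' \<in> histories r n (n * (n - 1))"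
  obtains \<sigma> \<tau> where "\<sigma> permutes all_arcs n" "\<And>e. \<tau> e permutes {1..r}" "h' = map (\<lambda>(e, c). (\<sigma> e, \<tau> e c)) h"
proof -
  let ?A = "all_arcs n" and ?es = "map fst h" and ?es' = "map fst h'"
  have full: "set (map fst g) = ?A" if "g \<in> histories r n (n * (n - 1))" for g
  proof (rule card_subset_eq)
    show "card (set (map fst g)) = card ?A"
      using that distinct_card[of "map fst g"] by (simp add: histories_def card_all_arcs)
  qed (use that in \<open>auto simp: histories_def\<close>)
  have es: "set ?es = ?A" "distinct ?es" "set ?es' = ?A" "distinct ?es'" "length h = length h'"
    using h h' full by (simp_all add: histories_def)
  \<comment> \<open>Complete histories list every arc exactly once, so sending the arc at each place
    of \<open>h\<close> to the arc at the same place of \<open>h'\<close> gives a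
    permutation.\<close>
  define \<sigma> where "\<sigma> e = (if e \<in> ?A then the (map_of (zip ?es ?es') e) else e)" for e
  have \<sigma>_nth: "\<sigma> (fst (h ! j)) = fst (h' ! j)" if "j < length h" for j
  proof -
    have "map_of (zip ?es ?es') (?es ! j) = Some (?es' ! j)"
      using es that by (intro map_of_zip_nth) auto
    moreover have "fst (h ! j) \<in> ?A" using that es(1) by (metis length_map nth_map nth_mem)
    ultimately show ?thesis using that es(5) by (simp add: \<sigma>_def)
  qed
  have map\<sigma>: "map \<sigma> ?es = ?es'" using es(5) by (auto intro!: nth_equalityI simp: \<sigma>_nth)
  have "\<sigma> ` ?A = ?A" using es map\<sigma> by (metis set_map)
  moreover have "inj_on \<sigma> ?A" using es map\<sigma> by (metis distinct_map)
  ultimately have perm: "\<sigma> permutes ?A"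
    by (intro bij_imp_permutes) (auto simp: bij_betw_def \<sigma>_def)
  define c c' where "c e = the (map_of h e)" and "c' e = the (map_of h' e)" for e
  have c: "c (fst (h ! j)) = snd (h ! j)" "c' (fst (h' ! j)) = snd (h' ! j)"
      "snd (h ! j) \<in> {1..r}" "snd (h' ! j) \<in> {1..r}" if "j < length h" for j
  proof -
    have m: "h ! j \<in> set h" "h' ! j \<in> set h'" using that es(5) by auto
    then have "map_of h (fst (h ! j)) = Some (snd (h ! j))" "map_of h' (fst (h' ! j)) = Some (snd (h' ! j))"
      using es(2,4) by (simp_all add: map_of_eq_Some_iff)
    then show "c (fst (h ! j)) = snd (h ! j)" "c' (fst (h' ! j)) = snd (h' ! j)" by (simp_all add: c_def c'_def)
    show "snd (h ! j) \<in> {1..r}" "snd (h' ! j) \<in> {1..r}" using m h h' by (auto simp: histories_def)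
  qed
  \<comment> \<open>Only one color has to be mapped correctly at each arc, so a transposition is
    enough.\<close>
  define \<tau> where "\<tau> e = (if e \<in> ?A then Transposition.transpose (c e) (c' (\<sigma> e)) else id)" for e
  have "\<tau> e permutes {1..r}" for e
  proof (cases "e \<in> ?A")
    case True
    then obtain j where "j < length h" "e = fst (h ! j)" using es(1) by (metis in_set_conv_nth length_map nth_map)
    then show ?thesis using c[of j] \<sigma>_nth[of j] True by (auto simp: \<tau>_def intro!: permutes_swap_id)
  qed (simp add: \<tau>_def permutes_id)
  moreover have "h' = map (\<lambda>(e, c). (\<sigma> e, \<tau> e c)) h"
  proof (rule nth_equalityI)
    fix j assume "j < length h'"
    then have j: "j < length h" using es(5) by simp
    have "fst (h ! j) \<in> ?A" using j es(1) by (metis length_map nth_map nth_mem)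
    then have "\<tau> (fst (h ! j)) (snd (h ! j)) = snd (h' ! j)"
      using c[OF j] \<sigma>_nth[OF j] by (simp add: \<tau>_def)
    then show "h' ! j = map (\<lambda>(e, c). (\<sigma> e, \<tau> e c)) h ! j"
      using j \<sigma>_nth[OF j] by (simp add: case_prod_beta prod_eq_iff)
  qed (use es in simp)
  ultimately show ?thesis using perm that by blast
qed

lemma full_process_joint:
  assumes r: "r \<ge> 1"
  shows "full_process r n = map_pmf snd (joint r n M)"
proof -
  let ?N = "n * (n - 1)" and ?J = "map_pmf snd (joint r n M)"
  have ne: "histories r n ?N \<noteq> {}" and full: "full_process r n = pmf_of_set (histories r n ?N)"
    using colored_process_uniform[OF r, of ?N n] by (auto simp: full_process_def)
  obtain h0 where h0: "h0 \<in> histories r n ?N" using ne by blast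
  have sub: "set_pmf ?J \<subseteq> histories r n ?N"
  proof
    fix h assume "h \<in> set_pmf ?J"
    then obtain f es where f: "f \<in> set_pmf (omega r n M)" and es: "es \<in> orders n f" and h: "h = label f es"
      by (auto simp: joint_def)
    then have *: "set es = all_arcs n" "distinct es" by (auto simp: orders_def permutations_of_set_def)
    then have "length es = ?N" using distinct_card[of es] by (simp add: card_all_arcs)
    then show "h \<in> histories r n ?N"
      using * set_omega[OF r f] by (auto simp: h label_def histories_def o_def)
  qed
  have "pmf ?J h = pmf ?J h0" if h: "h \<in> histories r n ?N" for h
  proof -
    obtain \<sigma> \<tau> where st: "\<sigma> permutes all_arcs n" "\<And>e. \<tau> e permutes {1..r}" "h = map (\<lambda>(e, c). (\<sigma> e, \<tau> e c)) h0"
      using histories_transitive[OF h0 h] by blast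
    let ?\<Psi> = "map (\<lambda>(e, c). (\<sigma> e, \<tau> e c))"
    have "inj (\<lambda>(e, c). (\<sigma> e, \<tau> e c))"
      by (rule injI) (use permutes_inj[OF st(1)] permutes_inj[OF st(2)] in \<open>auto dest: injD\<close>)
    then have "inj ?\<Psi>" by simp
    then have "pmf (map_pmf ?\<Psi> ?J) (?\<Psi> h0) = pmf ?J h0" by (rule pmf_map_inj')
    then show ?thesis using joint_invariant[OF st(1,2) r] st(3) by simp
  qed
  from pmf_of_set_eqI[OF finite_histories sub this] full show ?thesis by simp
qed

lemma sorted_set_takeWhile:
  "sorted (map g es) \<Longrightarrow> set (takeWhile (\<lambda>e. g e \<le> m) es) = {e \<in> set es. g e \<le> (m :: nat)}"
  by (induction es) force+

text \<open>Transfers an event from the process to the product space along the coupling. Here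
  \<open>a\<close> and \<open>b\<close> are times at which the process has exactly the arcs of mark
  0, respectively of mark at most 1.\<close>

lemma prob_full_process_le:
  assumes r: "r \<ge> 1"
    and *: "\<And>f h a b. f \<in> set_pmf (omega r n M) \<Longrightarrow> h \<in> X \<Longrightarrow>
      fst ` set h = all_arcs n \<Longrightarrow> (\<And>e. e \<in> all_arcs n \<Longrightarrow> coloring h e = snd (f e)) \<Longrightarrow>
      arcs0 n f = fst ` set (take a h) \<Longrightarrow> arcs1 n f = fst ` set (take b h) \<Longrightarrow> f \<in> Y"
  shows "measure_pmf.prob (full_process r n) X \<le> measure_pmf.prob (omega r n M) Y"
proof -
  have om: "omega r n M = map_pmf fst (joint r n M)"
    by (simp add: joint_def map_bind_pmf pmf.map_comp o_def map_pmf_const bind_return_pmf')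
  have "measure_pmf.prob (full_process r n) X = measure_pmf.prob (joint r n M) (snd -` X)"
    by (subst full_process_joint[OF r, of n M]) simp
  also have "\<dots> \<le> measure_pmf.prob (joint r n M) (fst -` Y)"
  proof (rule measure_pmf.finite_measure_mono_AE)
    show "AE x in joint r n M. x \<in> snd -` X \<longrightarrow> x \<in> fst -` Y"
    proof (rule AE_pmfI)
      fix x assume "x \<in> set_pmf (joint r n M)"
      then obtain f es where f: "f \<in> set_pmf (omega r n M)" and es: "es \<in> orders n f" and x: "x = (f, label f es)"
        by (auto simp: joint_def)
      then have e: "set es = all_arcs n" "distinct es" "sorted (map (\<lambda>e. fst (f e)) es)"
        by (auto simp: orders_def permutations_of_set_def)
      have t: "fst ` set (take a (label f es)) = set (take a es)" for a
        by (simp add: label_def take_map image_image)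
      have d: "distinct (map fst (label f es))" "fst ` set (label f es) = all_arcs n"
        using e by (auto simp: label_def o_def image_image)
      have co: "coloring (label f es) e = snd (f e)" if "e \<in> all_arcs n" for e
      proof -
        have "(e, snd (f e)) \<in> set (label f es)" using that e by (auto simp: label_def)
        then show ?thesis using d(1) by (simp add: coloring_def map_of_eq_Some_iff)
      qed
      \<comment> \<open>Marks increase along the order, so the arcs of mark at most \<open>m\<close>
        form an initial segment.\<close>
      have "\<exists>a. {e \<in> all_arcs n. fst (f e) \<le> m} = fst ` set (take a (label f es))" for m
        unfolding t by (intro exI[of _ "length (takeWhile (\<lambda>e. fst (f e) \<le> m) es)"])
          (simp add: takeWhile_eq_take[symmetric] sorted_set_takeWhile[OF e(3)] e(1))
      from this[of 0] this[of 1] obtain a b where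
        "arcs0 n f = fst ` set (take a (label f es))" "arcs1 n f = fst ` set (take b (label f es))"
        by (auto simp: arcs0_def arcs1_def)
      then show "x \<in> snd -` X \<longrightarrow> x \<in> fst -` Y" using *[OF f _ d(2) co] by (simp add: x)
    qed
  qed simp
  also have "\<dots> = measure_pmf.prob (omega r n M) Y" by (subst om) simp
  finally show ?thesis .
qed

section \<open>Product measures\<close>

text \<open>Fubini for the coordinates in \<open>B\<close> and the remaining ones: a good exposed
  part \<open>g\<close> contributes at most \<open>\<epsilon>\<close>, a bad one nothing.\<close>

lemma prob_Pi_pmf_two_stage:
  assumes fin: "finite A" and B: "B \<subseteq> A" and eps: "\<epsilon> \<ge> 0"
    and le: "\<And>g. g \<in> Y \<Longrightarrow> measure_pmf.prob (Pi_pmf (A - B) d p) {h. (\<lambda>x. if x \<in> B then g x else h x) \<in> X} \<le> \<epsilon>"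
    and zero: "\<And>g h. g \<notin> Y \<Longrightarrow> (\<lambda>x. if x \<in> B then g x else h x) \<notin> X"
  shows "measure_pmf.prob (Pi_pmf A d p) X \<le> \<epsilon> * measure_pmf.prob (Pi_pmf B d p) Y"
proof -
  have finB: "finite B" using B fin finite_subset by blast
  have "Pi_pmf A d p = Pi_pmf (B \<union> (A - B)) d p" using B by (simp add: Un_absorb1)
  also have "\<dots> = map_pmf (\<lambda>(f, g) x. if x \<in> B then f x else g x) (pair_pmf (Pi_pmf B d p) (Pi_pmf (A - B) d p))"
    by (rule Pi_pmf_union) (use fin finB in auto)
  also have "\<dots> = Pi_pmf B d p \<bind> (\<lambda>g. map_pmf (\<lambda>h x. if x \<in> B then g x else h x) (Pi_pmf (A - B) d p))"
    by (simp add: pair_pmf_def map_bind_pmf map_pmf_def bind_assoc_pmf bind_return_pmf)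
  finally have "emeasure (Pi_pmf A d p) X =
      (\<integral>\<^sup>+ g. emeasure (map_pmf (\<lambda>h x. if x \<in> B then g x else h x) (Pi_pmf (A - B) d p)) X \<partial>Pi_pmf B d p)"
    by simp
  also have "\<dots> \<le> (\<integral>\<^sup>+ g. ennreal \<epsilon> * indicator Y g \<partial>Pi_pmf B d p)"
  proof (rule nn_integral_mono)
    fix g
    have eq: "emeasure (map_pmf (\<lambda>h x. if x \<in> B then g x else h x) (Pi_pmf (A - B) d p)) X =
       measure_pmf.prob (Pi_pmf (A - B) d p) {h. (\<lambda>x. if x \<in> B then g x else h x) \<in> X}"
      by (simp add: measure_pmf.emeasure_eq_measure vimage_def)
    show "emeasure (map_pmf (\<lambda>h x. if x \<in> B then g x else h x) (Pi_pmf (A - B) d p)) X \<le> ennreal \<epsilon> * indicator Y g"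
    proof (cases "g \<in> Y")
      case True
      then show ?thesis unfolding eq using le eps by (simp add: ennreal_leI)
    next
      case False
      then show ?thesis unfolding eq using zero by simp
    qed
  qed
  also have "\<dots> = ennreal \<epsilon> * emeasure (Pi_pmf B d p) Y" by (simp add: nn_integral_cmult_indicator)
  also have "\<dots> = ennreal (\<epsilon> * measure_pmf.prob (Pi_pmf B d p) Y)"
    using eps by (simp add: measure_pmf.emeasure_eq_measure ennreal_mult)
  finally show ?thesis using eps by (simp add: measure_pmf.emeasure_eq_measure)
qed

text \<open>The indicator of \<open>X\<close> is dominated by a product of functions of single
  coordinates, whose expectation factorizes. Indicator factors express prescribed coordinates,
  damping factors give Chernoff bounds.\<close>

lemma prob_Pi_pmf_le_prod:
  fixes g :: "'a \<Rightarrow> 'b \<Rightarrow> real"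
  assumes fin: "finite A" and S: "S \<subseteq> A" and c: "c \<ge> 0"
    and g: "\<And>e y. 0 \<le> g e y" "\<And>e y. g e y \<le> 1"
    and X: "\<And>f. f \<in> X \<Longrightarrow> 1 \<le> c * (\<Prod>e\<in>S. g e (f e))"
  shows "measure_pmf.prob (Pi_pmf A d p) X \<le> c * (\<Prod>e\<in>S. measure_pmf.expectation (p e) (g e))"
proof -
  let ?P = "Pi_pmf A d p"
  \<comment> \<open>Padding with the constant 1 outside \<open>S\<close> turns the product into one
    over all coordinates.\<close>
  define g' where "g' e y = (if e \<in> S then g e y else 1)" for e y
  have g': "0 \<le> g' e y" "g' e y \<le> 1" for e y using g by (auto simp: g'_def)
  have int: "integrable (measure_pmf (p e)) (g' e)" for e
    by (rule measure_pmf.integrable_const_bound[where B = 1]) (use g' in auto)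
  have ext: "(\<Prod>e\<in>A. h e) = (\<Prod>e\<in>S. h e)" if "\<And>e. e \<in> A - S \<Longrightarrow> h e = 1" for h :: "'a \<Rightarrow> real"
    using fin S that by (intro prod.mono_neutral_right) auto
  have "measure_pmf.prob ?P X = measure_pmf.expectation ?P (indicator X)" by simp
  also have "\<dots> \<le> measure_pmf.expectation ?P (\<lambda>f. c * (\<Prod>e\<in>A. g' e (f e)))"
  proof (rule integral_mono)
    have b: "(\<Prod>e\<in>A. g' e (f e)) \<in> {0..1}" for f using g' by (auto intro: prod_nonneg prod_le_1)
    show "integrable ?P (\<lambda>f. c * (\<Prod>e\<in>A. g' e (f e)))"
      by (intro integrable_mult_right measure_pmf.integrable_const_bound[where B = 1]) (use b in auto)
    show "integrable ?P (indicator X :: _ \<Rightarrow> real)"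
      by (rule measure_pmf.integrable_const_bound[where B = 1]) (auto simp: indicator_def)
    fix f
    have "(\<Prod>e\<in>A. g' e (f e)) = (\<Prod>e\<in>S. g e (f e))" by (subst ext) (auto simp: g'_def)
    then show "indicator X f \<le> c * (\<Prod>e\<in>A. g' e (f e))"
      using X[of f] b[of f] c by (auto simp: indicator_def)
  qed
  also have "\<dots> = c * (\<Prod>e\<in>A. measure_pmf.expectation (p e) (g' e))"
    using int g' by (simp add: expectation_prod_Pi_pmf[OF fin])
  also have "(\<Prod>e\<in>A. measure_pmf.expectation (p e) (g' e)) = (\<Prod>e\<in>S. measure_pmf.expectation (p e) (g e))"
  proof (subst ext)
    have "g' e = (\<lambda>_. 1)" if "e \<notin> S" for e using that by (simp add: g'_def fun_eq_iff)
    then show "measure_pmf.expectation (p e) (g' e) = 1" if "e \<in> A - S" for e using that by simp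
    have "g' e = g e" if "e \<in> S" for e using that by (simp add: g'_def fun_eq_iff)
    then show "(\<Prod>e\<in>S. measure_pmf.expectation (p e) (g' e)) = (\<Prod>e\<in>S. measure_pmf.expectation (p e) (g e))"
      by (intro prod.cong) simp_all
  qed
  finally show ?thesis .
qed

text \<open>Events depending on disjoint groups of coordinates are independent; the two-stage bound
  adds one group at a time.\<close>

lemma prob_Pi_pmf_groups:
  assumes "finite I" and "\<And>i. i \<in> I \<Longrightarrow> finite (S i)" and "disjoint_family_on S I"
    and "\<And>i. i \<in> I \<Longrightarrow> measure_pmf.prob (Pi_pmf (S i) d p) {f. Q i f} \<le> b"
    and loc: "\<And>i f g. (\<And>e. e \<in> S i \<Longrightarrow> f e = g e) \<Longrightarrow> Q i f \<Longrightarrow> Q i g" and b: "b \<ge> 0"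
  shows "measure_pmf.prob (Pi_pmf (\<Union>i\<in>I. S i) d p) {f. \<forall>i\<in>I. Q i f} \<le> b ^ card I"
  using assms(1-4)
proof (induction I rule: finite_induct)
  case (insert i I)
  let ?U = "\<Union>i\<in>I. S i" and ?A = "\<Union>i\<in>insert i I. S i"
  have dj: "S i \<inter> ?U = {}" using insert.hyps(2) insert.prems(2) by (fastforce simp: disjoint_family_on_def)
  then have diff: "?A - ?U = S i" by auto
  have IH: "measure_pmf.prob (Pi_pmf ?U d p) {f. \<forall>i\<in>I. Q i f} \<le> b ^ card I"
    using insert.prems by (intro insert.IH) (auto simp: disjoint_family_on_def)
  have m1: "Q i h" if "Q i (\<lambda>x. if x \<in> ?U then g x else h x)" for g h
    by (rule loc[OF _ that]) (use dj in auto)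
  have m2: "Q j g" if "Q j (\<lambda>x. if x \<in> ?U then g x else h x)" "j \<in> I" for g h j
    by (rule loc[OF _ that(1)]) (use that(2) in auto)
  have "measure_pmf.prob (Pi_pmf ?A d p) {f. \<forall>i\<in>insert i I. Q i f} \<le>
      b * measure_pmf.prob (Pi_pmf ?U d p) {f. \<forall>i\<in>I. Q i f}"
  proof (rule prob_Pi_pmf_two_stage)
    fix g
    have "measure_pmf.prob (Pi_pmf (S i) d p) {h. (\<lambda>x. if x \<in> ?U then g x else h x) \<in> {f. \<forall>i\<in>insert i I. Q i f}}
        \<le> measure_pmf.prob (Pi_pmf (S i) d p) {f. Q i f}"
      by (intro measure_pmf.finite_measure_mono subsetI) (use m1 in \<open>simp_all only: mem_Collect_eq ball_simps sets_measure_pmf UNIV_I, blast\<close>)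
    also have "\<dots> \<le> b" using insert.prems by simp
    finally show "measure_pmf.prob (Pi_pmf (?A - ?U) d p) {h. (\<lambda>x. if x \<in> ?U then g x else h x) \<in> {f. \<forall>i\<in>insert i I. Q i f}} \<le> b"
      unfolding diff .
  next
    fix g h
    assume "g \<notin> {f. \<forall>i\<in>I. Q i f}"
    then show "(\<lambda>x. if x \<in> ?U then g x else h x) \<notin> {f. \<forall>i\<in>insert i I. Q i f}" using m2 by blast
  qed (use insert b in auto)
  also have "\<dots> \<le> b * b ^ card I" using IH b by (intro mult_left_mono)
  finally show ?case using insert.hyps by simp
qed simp

lemma prob_Ex_le:
  fixes \<epsilon> :: real
  assumes "finite I" "\<And>i. i \<in> I \<Longrightarrow> measure_pmf.prob M {x. Q i x} \<le> \<epsilon>"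
  shows "measure_pmf.prob M {x. \<exists>i\<in>I. Q i x} \<le> card I * \<epsilon>"
proof -
  have "measure_pmf.prob M {x. \<exists>i\<in>I. Q i x} = measure_pmf.prob M (\<Union>i\<in>I. {x. Q i x})"
    by (rule arg_cong[where f = "measure_pmf.prob M"]) auto
  also have "\<dots> \<le> (\<Sum>i\<in>I. measure_pmf.prob M {x. Q i x})"
    by (rule measure_pmf.finite_measure_subadditive_finite) (use assms in auto)
  also have "\<dots> \<le> card I * \<epsilon>" using sum_bounded_above[of I _ \<epsilon>] assms(2) by simp
  finally show ?thesis .
qed

lemma prob_disj_le: "measure_pmf.prob M {x. A x \<or> B x} \<le> measure_pmf.prob M {x. A x} + measure_pmf.prob M {x. B x}"
  using measure_subadditive[of "{x. A x}" "measure_pmf M" "{x. B x}"] by (simp add: Collect_disj_eq measure_pmf.emeasure_eq_measure)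

text \<open>\<open>J\<close> is meant to be a full index box with a simple cardinality, and
  \<open>I\<close> its part on which the individual bound is available.\<close>

lemma prob_Ex_index_le:
  fixes \<epsilon> :: real
  assumes "finite J" "I \<subseteq> J" "\<And>i. i \<in> I \<Longrightarrow> measure_pmf.prob M {x. Q i x} \<le> \<epsilon>" "\<epsilon> \<ge> 0"
  shows "measure_pmf.prob M {x. \<exists>i\<in>I. Q i x} \<le> card J * \<epsilon>"
proof -
  have "finite I" using assms finite_subset by blast
  then have "measure_pmf.prob M {x. \<exists>i\<in>I. Q i x} \<le> card I * \<epsilon>" by (rule prob_Ex_le) (rule assms(3))
  also have "\<dots> \<le> card J * \<epsilon>" using card_mono[OF assms(1,2)] assms(4) by (intro mult_right_mono) simp_all
  finally show ?thesis .
qed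

section \<open>The law of a single arc and a bound for prescribed arc profiles\<close>

definition marks :: "real \<Rightarrow> real \<Rightarrow> nat pmf" where
  "marks p0 p1 = bernoulli_pmf p1 \<bind> (\<lambda>b. if b then map_pmf (\<lambda>c. if c then 0 else 1) (bernoulli_pmf (p0 / p1)) else return_pmf 2)"

lemma marks:
  assumes "0 < p0" "p0 \<le> p1" "p1 \<le> 1"
  shows "pmf (marks p0 p1) 0 = p0" "pmf (marks p0 p1) 1 = p1 - p0"
proof -
  have v: "(\<lambda>c. if c then 0 else 1 :: nat) -` {0} = {True}" "(\<lambda>c. if c then 0 else 1 :: nat) -` {1} = {False}" by (auto split: if_splits)
  have q: "p0 / p1 \<in> {0..1}" using assms by (auto simp: field_simps)
  note simps = marks_def pmf_bind integral_bernoulli_pmf pmf_map v measure_pmf_single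
  show "pmf (marks p0 p1) 0 = p0" using assms q by (simp add: simps del: One_nat_def)
  show "pmf (marks p0 p1) 1 = p1 - p0" using assms q by (simp add: simps field_simps)
qed

lemma prob_marks:
  assumes "0 < p0" "p0 \<le> p1" "p1 \<le> 1"
  shows "measure_pmf.prob (marks p0 p1) {m. m \<le> 1} = p1"
proof -
  have "measure_pmf.prob (marks p0 p1) {m. m \<le> 1} = measure_pmf.prob (marks p0 p1) {0, 1}"
    by (rule arg_cong[where f = "measure_pmf.prob _"]) auto
  then show ?thesis using marks[OF assms] by (simp add: measure_measure_pmf_finite)
qed

lemma prob_pair_pmf_fst: "measure_pmf.prob (pair_pmf M N) {y. fst y \<in> S} = measure_pmf.prob M S"
proof -
  have "measure_pmf.prob M S = measure_pmf.prob (map_pmf fst (pair_pmf M N)) S" by (simp add: map_fst_pair_pmf)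
  then show ?thesis by (simp add: vimage_def)
qed

text \<open>\<open>\<eta>\<close> is the weight given to arcs of mark 0 in the Chernoff bound; the
  final choice of \<open>p0\<close> uses the same number as its slack below
  \<open>ln n / n\<close>.\<close>

locale sparse_model =
  fixes r n :: nat and p0 p1 \<eta> :: real
  assumes r: "r \<ge> 1" and p: "0 < p0" "p0 \<le> p1" "p1 \<le> 1" and \<eta>: "0 < \<eta>" "\<eta> \<le> 1"
begin

abbreviation arc_pmf :: "(nat \<times> nat) pmf" where
  "arc_pmf \<equiv> pair_pmf (marks p0 p1) (pmf_of_set {1..r})"

lemma prob_mark0: "measure_pmf.prob arc_pmf {y. fst y = 0} = p0"
  using prob_pair_pmf_fst[of "marks p0 p1" _ "{0}"] marks[OF p] by (simp add: measure_pmf_single)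

lemma prob_mark1: "measure_pmf.prob arc_pmf {y. fst y \<le> 1} = p1"
  using prob_pair_pmf_fst[of "marks p0 p1" _ "{m. m \<le> 1}"] prob_marks[OF p] by simp

lemma prob_mark0_color:
  assumes "c \<in> {1..r}"
  shows "measure_pmf.prob arc_pmf {y. \<not> (fst y = 0 \<and> snd y = c)} = 1 - p0 / r"
proof -
  have "measure_pmf.prob arc_pmf {y. \<not> (fst y = 0 \<and> snd y = c)} = measure_pmf.prob arc_pmf (UNIV - {(0, c)})"
    by (rule arg_cong[where f = "measure_pmf.prob _"]) auto
  also have "\<dots> = 1 - pmf arc_pmf (0, c)"
    using measure_pmf.prob_compl[of "{(0, c)}" arc_pmf] by (simp add: measure_pmf_single)
  also have "pmf arc_pmf (0, c) = p0 / r" using assms marks[OF p] by (simp add: pmf_pair)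
  finally show ?thesis .
qed

lemma expectation_damped: "measure_pmf.expectation arc_pmf (\<lambda>y. if fst y = 0 then \<eta> else 1) = 1 - (1 - \<eta>) * p0"
proof -
  have "measure_pmf.expectation arc_pmf (\<lambda>y. if fst y = 0 then \<eta> else 1) =
      measure_pmf.expectation arc_pmf (\<lambda>y. 1 - (1 - \<eta>) * indicator {y. fst y = 0} y)"
    by (intro arg_cong[where f = "measure_pmf.expectation _"]) (auto simp: indicator_def)
  also have "\<dots> = 1 - (1 - \<eta>) * measure_pmf.prob arc_pmf {y. fst y = 0}"
    by (subst Bochner_Integration.integral_diff) (auto intro!: integrable_mult_right integrable_real_indicator simp: measure_pmf.emeasure_eq_measure)
  finally show ?thesis by (simp add: prob_mark0)
qed

text \<open>The constraint on \<open>S1\<close> is handled as in a Chernoff bound: its indicator is at most \<open>\<eta>\<close> to the power of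
  the number of arcs of mark \<open>0\<close> in \<open>S1\<close>, divided by \<open>\<eta> ^ m\<close>.\<close>

lemma prob_profile:
  fixes A S1 S2 S3 :: "'a set"
  assumes fin: "finite A" and sub: "S1 \<subseteq> A" "S2 \<subseteq> A" "S3 \<subseteq> A"
    and dj: "S1 \<inter> S2 = {}" "S1 \<inter> S3 = {}" "S2 \<inter> S3 = {}" and c: "c \<in> {1..r}"
    and X: "\<And>f. f \<in> X \<Longrightarrow> card {e \<in> S1. fst (f e) = 0} \<le> m"
      "\<And>f e. f \<in> X \<Longrightarrow> e \<in> S2 \<Longrightarrow> fst (f e) \<le> 1"
      "\<And>f e. f \<in> X \<Longrightarrow> e \<in> S3 \<Longrightarrow> \<not> (fst (f e) = 0 \<and> snd (f e) = c)"
  shows "measure_pmf.prob (Pi_pmf A d (\<lambda>_. arc_pmf)) X \<le>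
    (1 / \<eta>) ^ m * (1 - (1 - \<eta>) * p0) ^ card S1 * p1 ^ card S2 * (1 - p0 / r) ^ card S3"
proof -
  have f: "finite S1" "finite S2" "finite S3" using fin sub finite_subset by blast+
  define g :: "'a \<Rightarrow> nat \<times> nat \<Rightarrow> real" where "g e = (if e \<in> S1 then (\<lambda>y. if fst y = 0 then \<eta> else 1)
      else if e \<in> S2 then indicator {y. fst y \<le> 1} else indicator {y. \<not> (fst y = 0 \<and> snd y = c)})" for e
  have split: "(\<Prod>e\<in>S1 \<union> S2 \<union> S3. h e) = (\<Prod>e\<in>S1. h e) * (\<Prod>e\<in>S2. h e) * (\<Prod>e\<in>S3. h e)" for h :: "'a \<Rightarrow> real"
    using f dj by (subst prod.union_disjoint; (subst prod.union_disjoint)?) auto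
  have "measure_pmf.prob (Pi_pmf A d (\<lambda>_. arc_pmf)) X \<le>
     (1 / \<eta>) ^ m * (\<Prod>e\<in>S1 \<union> S2 \<union> S3. measure_pmf.expectation arc_pmf (g e))"
  proof (rule prob_Pi_pmf_le_prod[OF fin])
    fix h assume h: "h \<in> X"
    have "(\<Prod>e\<in>S2. g e (h e)) = 1" using X(2)[OF h] dj by (intro prod.neutral) (auto simp: g_def)
    moreover have "(\<Prod>e\<in>S3. g e (h e)) = 1" using X(3)[OF h] dj by (intro prod.neutral) (auto simp: g_def)
    moreover have "(\<Prod>e\<in>S1. g e (h e)) = (\<Prod>e\<in>{e \<in> S1. fst (h e) = 0}. \<eta>)"
      using f by (intro prod.mono_neutral_cong_right) (auto simp: g_def)
    ultimately have "(\<Prod>e\<in>S1 \<union> S2 \<union> S3. g e (h e)) = \<eta> ^ card {e \<in> S1. fst (h e) = 0}" by (simp add: split)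
    also have "\<dots> \<ge> \<eta> ^ m" using X(1)[OF h] \<eta> by (intro power_decreasing) auto
    finally have "(1 / \<eta>) ^ m * \<eta> ^ m \<le> (1 / \<eta>) ^ m * (\<Prod>e\<in>S1 \<union> S2 \<union> S3. g e (h e))"
      using \<eta> by (intro mult_left_mono) auto
    then show "1 \<le> (1 / \<eta>) ^ m * (\<Prod>e\<in>S1 \<union> S2 \<union> S3. g e (h e))"
      using \<eta> by (simp add: power_mult_distrib[symmetric])
  qed (use sub \<eta> in \<open>auto simp: g_def indicator_def\<close>)
  moreover have "(\<Prod>e\<in>S1. measure_pmf.expectation arc_pmf (g e)) = (\<Prod>e\<in>S1. 1 - (1 - \<eta>) * p0)"
    by (intro prod.cong) (simp_all add: g_def expectation_damped)
  moreover have "(\<Prod>e\<in>S2. measure_pmf.expectation arc_pmf (g e)) = (\<Prod>e\<in>S2. p1)"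
    using dj by (intro prod.cong) (auto simp: g_def prob_mark1)
  moreover have "(\<Prod>e\<in>S3. measure_pmf.expectation arc_pmf (g e)) = (\<Prod>e\<in>S3. 1 - p0 / r)"
    using dj prob_mark0_color[OF c] by (intro prod.cong) (auto simp: g_def)
  ultimately show ?thesis by (simp add: split mult.assoc)
qed

end

section \<open>Exceptional events\<close>

lemma orient_inj [simp]: "orient d u x = orient d u y \<longleftrightarrow> x = y"
  by (auto simp: orient_def)

lemma card_orient_image: "card (orient d u ` X) = card X"
  by (rule card_image) (simp add: inj_on_def)

lemma orient_in_all_arcs [simp]: "orient d u x \<in> all_arcs n \<longleftrightarrow> u \<in> {1..n} \<and> x \<in> {1..n} \<and> u \<noteq> x"
  by (auto simp: orient_def all_arcs_def)

section \<open>Conditioning on the arcs inside one zone\<close>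

definition inner_arcs :: "nat \<Rightarrow> nat list \<Rightarrow> nat \<Rightarrow> nat \<Rightarrow> arc set" where
  "inner_arcs n P s k = all_arcs n \<inter> zone s P k \<times> zone s P k"

definition glue :: "'a set \<Rightarrow> ('a \<Rightarrow> 'b) \<Rightarrow> ('a \<Rightarrow> 'b) \<Rightarrow> 'a \<Rightarrow> 'b" where
  "glue B g h x = (if x \<in> B then g x else h x)"

lemma layered_inner: "layered n P s k f \<subseteq> inner_arcs n P s k"
proof -
  have "Suc i mod length P < length P" if "i < length P" for i using that by (intro mod_less_divisor) linarith
  then show ?thesis by (auto simp: layered_def inner_arcs_def arcs0_def zone_def)
qed

text \<open>Layered arcs have both ends in the zone; hence \<open>core\<close> and
  \<open>target\<close> are functions of the inner arcs alone and can be fixed by exposing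
  these.\<close>

lemma layered_glue: "layered n P s k (glue (inner_arcs n P s k) g h) = layered n P s k g"
proof (rule set_eqI)
  fix e :: arc
  show "e \<in> layered n P s k (glue (inner_arcs n P s k) g h) \<longleftrightarrow> e \<in> layered n P s k g"
  proof (cases "e \<in> inner_arcs n P s k")
    case True
    then show ?thesis by (cases e) (simp add: layered_def glue_def arcs0_def)
  next
    case False
    then show ?thesis using layered_inner by blast
  qed
qed

lemma core_glue: "core n P s k (glue (inner_arcs n P s k) g h) = core n P s k g"
  by (simp add: core_def layered_glue)

lemma target_glue: "target d n P s k (glue (inner_arcs n P s k) g h) = target d n P s k g"
  by (simp add: target_def layered_glue fun_eq_iff)

lemma core_target:
  assumes "core n P s k f" and s: "s > 0" and i: "i < length P"
  shows "target d n P s k f i \<subseteq> zone s P k" "card (target d n P s k f i) \<ge> 2 * s"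
proof -
  let ?l = "length P" and ?R = "layered n P s k f"
  have l: "?l > 0" using i by linarith
  then have i': "Suc i mod ?l < ?l" by simp
  show "target d n P s k f i \<subseteq> zone s P k"
    using blk_subset_zone[OF i, of s k] blk_subset_zone[OF i', of s k] by (auto simp: target_def)
  have ex: "expanding ?R (blk s k) (\<lambda>i. Suc i mod ?l) ?l s" using assms(1) by (simp add: core_def)
  have 1: "card (spreading ?R (blk s k) ?l s \<inter> blk s k (Suc i mod ?l)) \<ge> 2 * s"
    by (rule expanding_card_spreading[OF ex s]) (use l i' in auto)
  have 2: "card (spreading (?R\<inverse>) (blk s k) ?l s \<inter> blk s k i) \<ge> 2 * s"
    by (rule expanding_card_spreading[OF expanding_converse[OF ex] s]) (use l i in auto)
  show "card (target d n P s k f i) \<ge> 2 * s" using 1 2 by (simp add: target_def)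
qed

lemma finite_nbrs [simp]: "finite (nbrs d n f u)"
  by (rule finite_subset[of _ "{1..n}"]) (auto simp: nbrs_def arcs0_def)

section \<open>Probability of each exceptional event\<close>

locale zone_model = sparse_model +
  fixes P :: "nat list" and s :: nat
  assumes P: "set P \<subseteq> {1..r}" "P \<noteq> []" and s: "s > 0" "20 * length P * s \<le> n"
begin

abbreviation "\<alpha> \<equiv> 1 - (1 - \<eta>) * p0"
abbreviation "\<phi> \<equiv> 1 - p0 / r"
abbreviation "Om \<equiv> measure_pmf.prob (omega r n (marks p0 p1))"

lemma omega_Pi: "omega r n (marks p0 p1) = Pi_pmf (all_arcs n) (0, 0) (\<lambda>_. arc_pmf)"
  by (simp add: omega_def)

lemma phi: "0 \<le> \<phi>" "\<phi> \<le> 1"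
proof -
  have "p0 / r \<le> p0 / 1" using p r by (intro divide_left_mono) auto
  then show "0 \<le> \<phi>" using p by simp
  show "\<phi> \<le> 1" using p r by simp
qed

lemma alpha: "0 \<le> \<alpha>" "\<alpha> \<le> 1"
  using p \<eta> mult_mono[of "1 - \<eta>" 1 p0 1] by simp_all

lemma color: "i < length P \<Longrightarrow> P ! i \<in> {1..r}" using P(1) nth_mem[of i P] by blast

lemma n2: "n \<ge> 20"
proof -
  have "length P \<ge> 1" using P(2) by (cases P) auto
  then have "20 * 1 * 1 \<le> 20 * length P * s"
    using s(1) by (intro mult_mono) simp_all
  then show ?thesis using s(2) by linarith
qed

text \<open>Five zones of \<open>length P\<close> blocks with \<open>4 * s\<close> vertices each end
  at vertex \<open>20 * length P * s\<close>.\<close>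

lemma blk_subset: "k < 5 \<Longrightarrow> i < length P \<Longrightarrow> blk s k i \<subseteq> {1..n}"
proof -
  assume "k < 5" "i < length P"
  then have "5 * i + k + 1 \<le> 5 * length P" by linarith
  then have "(5 * i + k + 1) * (4 * s) \<le> 5 * length P * (4 * s)" by (rule mult_le_mono1)
  also have "\<dots> = 20 * length P * s" by simp
  also have "\<dots> \<le> n" by (rule s(2))
  finally have le: "(5 * i + k + 1) * (4 * s) \<le> n" .
  show ?thesis
  proof
    fix x assume "x \<in> blk s k i"
    then have "(5 * i + k) * (4 * s) < x" "x \<le> (5 * i + k + 1) * (4 * s)"
      by (simp_all only: blk_def greaterThanAtMost_iff)
    then have "0 < x" "x \<le> n" using le by (blast intro: le_less_trans order_trans)+
    then show "x \<in> {1..n}" by simp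
  qed
qed

lemma zone_subset: "k < 5 \<Longrightarrow> zone s P k \<subseteq> {1..n}"
  using blk_subset by (auto simp: zone_def)

text \<open>Union bound over the position and the pair of sets, subsets of two blocks of
  \<open>4 * s\<close> vertices. \<open>\<phi>\<close> is the probability that an arc fails to have
  mark 0 and the wanted color.\<close>

lemma prob_not_core:
  assumes k: "k < 5"
  shows "Om {f. \<not> core n P s k f} \<le> length P * 2 ^ (8 * s) * \<phi> ^ (s * s - s)"
proof -
  let ?l = "length P"
  let ?nx = "\<lambda>i. Suc i mod ?l"
  have l: "?l > 0" using P by simp
  define I where "I = {(i, S, T). i < ?l \<and> S \<subseteq> blk s k i \<and> T \<subseteq> blk s k (?nx i) \<and> card S = s \<and> card T = s}"
  have sub: "I \<subseteq> (SIGMA i:{..<?l}. Pow (blk s k i) \<times> Pow (blk s k (?nx i)))" by (auto simp: I_def)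
  have "finite I" by (rule finite_subset[OF sub]) auto
  have "card I \<le> card (SIGMA i:{..<?l}. Pow (blk s k i) \<times> Pow (blk s k (?nx i)))"
    by (rule card_mono[OF _ sub]) auto
  also have "\<dots> = ?l * 2 ^ (8 * s)" by (simp add: card_Pow card_cartesian_product flip: power_add)
  finally have cI: "card I \<le> ?l * 2 ^ (8 * s)" .
  let ?E = "\<lambda>S T. {(x, y) \<in> S \<times> T. x \<noteq> y}"
  let ?Q = "\<lambda>(i, S, T) f. \<forall>e\<in>?E S T. \<not> (fst (f e) = 0 \<and> snd (f e) = P ! i)"
  have "Om {f. ?Q j f} \<le> \<phi> ^ (s * s - s)" if "j \<in> I" for j
  proof -
    obtain i S T where j: "j = (i, S, T)" by (cases j)
    have i: "i < ?l" and S: "S \<subseteq> blk s k i" "card S = s" and T: "T \<subseteq> blk s k (?nx i)" "card T = s"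
      using that by (simp_all add: j I_def)
    have fin: "finite S" "finite T" using S T finite_blk finite_subset by blast+
    have "S \<subseteq> {1..n}" "T \<subseteq> {1..n}" using S T blk_subset[OF k i] blk_subset[OF k, of "?nx i"] l by auto
    then have E: "?E S T \<subseteq> all_arcs n" by (auto simp: all_arcs_def)
    \<comment> \<open>For a pattern of length 1 a block is its own successor, and \<open>S\<close>
      and \<open>T\<close> may overlap. The at most \<open>s\<close> diagonal pairs are not arcs,
      hence the exponent \<open>s * s - s\<close>.\<close>
    have eq: "S \<times> T = ?E S T \<union> (\<lambda>x. (x, x)) ` (S \<inter> T)" by auto
    have "card (S \<times> T) \<le> card (?E S T) + card ((\<lambda>x. (x, x)) ` (S \<inter> T))"
      by (subst eq, rule card_Un_le)
    moreover have "card ((\<lambda>x. (x, x)) ` (S \<inter> T)) \<le> card (S \<inter> T)" by (rule card_image_le) (simp add: fin)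
    moreover have "card (S \<inter> T) \<le> card S" using fin by (intro card_mono) auto
    moreover have "card (S \<times> T) = s * s" using S T by (simp add: card_cartesian_product)
    ultimately have cE: "s * s - s \<le> card (?E S T)" using S(2) by linarith
    have "Om {f. ?Q j f} \<le> (1 / \<eta>) ^ 0 * \<alpha> ^ card ({} :: arc set) * p1 ^ card ({} :: arc set) * \<phi> ^ card (?E S T)"
      unfolding omega_Pi
    proof (rule prob_profile[where c = "P ! i"])
      show "\<not> (fst (f e) = 0 \<and> snd (f e) = P ! i)" if "f \<in> {f. ?Q j f}" "e \<in> ?E S T" for f e
        using that unfolding j by blast
    qed (use E color[OF i] in simp_all)
    also have "\<dots> = \<phi> ^ card (?E S T)" by simp
    also have "\<dots> \<le> \<phi> ^ (s * s - s)" using cE phi by (intro power_decreasing) auto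
    finally show ?thesis .
  qed
  from prob_Ex_le[OF \<open>finite I\<close>, of _ ?Q, OF this]
  have le: "Om {f. \<exists>j\<in>I. ?Q j f} \<le> card I * \<phi> ^ (s * s - s)" .
  have "Om {f. \<not> core n P s k f} \<le> Om {f. \<exists>j\<in>I. ?Q j f}"
  proof (intro measure_pmf.finite_measure_mono subsetI CollectI)
    fix f assume "f \<in> {f. \<not> core n P s k f}"
    then obtain i S T where i: "i < ?l" and S: "S \<subseteq> blk s k i" "card S = s"
      and T: "T \<subseteq> blk s k (?nx i)" "card T = s" and none: "\<And>x y. x \<in> S \<Longrightarrow> y \<in> T \<Longrightarrow> (x, y) \<notin> layered n P s k f"
      unfolding core_def expanding_def by auto
    have i': "?nx i < ?l" using l by simp
    have "(x, y) \<in> layered n P s k f"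
      if "x \<in> S" "y \<in> T" "x \<noteq> y" "fst (f (x, y)) = 0" "snd (f (x, y)) = P ! i" for x y
    proof -
      have "x \<in> blk s k i" "y \<in> blk s k (?nx i)" using that S T by auto
      moreover have "(x, y) \<in> all_arcs n"
        using calculation that(3) blk_subset[OF k i] blk_subset[OF k i'] by (auto simp: all_arcs_def)
      ultimately show ?thesis using that i by (auto simp: layered_def arcs0_def)
    qed
    then have "?Q (i, S, T) f" using none by blast
    moreover have "(i, S, T) \<in> I" using i S T by (simp add: I_def)
    ultimately show "\<exists>j\<in>I. ?Q j f" by blast
  qed simp
  also note le
  also have "card I * \<phi> ^ (s * s - s) \<le> real (?l * 2 ^ (8 * s)) * \<phi> ^ (s * s - s)"
    using cI phi by (intro mult_right_mono) (simp_all only: of_nat_le_iff zero_le_power)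
  finally show ?thesis by simp
qed

text \<open>Expose the arcs inside the zone first: they determine \<open>core\<close> and \<open>target\<close>, and \<open>R\<close> depends on the other
  arcs only.\<close>

lemma prob_core_event:
  assumes k: "k < 5" and i: "i < length P" and eps: "\<epsilon> \<ge> 0"
    and loc: "\<And>T g h. R T (glue (inner_arcs n P s k) g h) \<Longrightarrow> R T h"
    and le: "\<And>T. T \<subseteq> zone s P k \<Longrightarrow> 2 * s \<le> card T \<Longrightarrow>
       measure_pmf.prob (Pi_pmf (all_arcs n - inner_arcs n P s k) (0, 0) (\<lambda>_. arc_pmf)) {f. R T f} \<le> \<epsilon>"
  shows "Om {f. core n P s k f \<and> R (target d n P s k f i) f} \<le> \<epsilon>"
proof -
  let ?B = "inner_arcs n P s k"
  let ?X = "{f. core n P s k f \<and> R (target d n P s k f i) f}"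
  have "Om ?X \<le> \<epsilon> * measure_pmf.prob (Pi_pmf ?B (0, 0) (\<lambda>_. arc_pmf)) {g. core n P s k g}"
    unfolding omega_Pi
  proof (rule prob_Pi_pmf_two_stage)
    show "?B \<subseteq> all_arcs n" by (auto simp: inner_arcs_def)
    fix g :: "arc \<Rightarrow> nat \<times> nat" assume "g \<in> {g. core n P s k g}"
    then have g: "core n P s k g" by simp
    have "{h. glue ?B g h \<in> ?X} \<subseteq> {f. R (target d n P s k g i) f}"
      using loc by (auto simp: core_glue target_glue)
    then have "measure_pmf.prob (Pi_pmf (all_arcs n - ?B) (0, 0) (\<lambda>_. arc_pmf)) {h. glue ?B g h \<in> ?X} \<le>
       measure_pmf.prob (Pi_pmf (all_arcs n - ?B) (0, 0) (\<lambda>_. arc_pmf)) {f. R (target d n P s k g i) f}"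
      by (intro measure_pmf.finite_measure_mono) auto
    also have "\<dots> \<le> \<epsilon>" using core_target[OF g s(1) i] le by blast
    finally show "measure_pmf.prob (Pi_pmf (all_arcs n - ?B) (0, 0) (\<lambda>_. arc_pmf))
        {h. (\<lambda>x. if x \<in> ?B then g x else h x) \<in> ?X} \<le> \<epsilon>" by (simp add: glue_def[abs_def])
  next
    fix g h :: "arc \<Rightarrow> nat \<times> nat" assume "g \<notin> {g. core n P s k g}"
    then have "glue ?B g h \<notin> ?X" by (simp add: core_glue)
    then show "(\<lambda>x. if x \<in> ?B then g x else h x) \<notin> ?X" by (simp add: glue_def[abs_def])
  qed (use eps in auto)
  also have "\<dots> \<le> \<epsilon> * 1" using eps by (intro mult_left_mono) auto
  finally show ?thesis by simp
qed

text \<open>With \<open>T\<close> fixed, three disjoint sets of arcs outside the zone are involved: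
  the \<open>n - 2\<close> arcs at \<open>u\<close> avoiding \<open>w\<close>, few of which have
  mark 0; the arc between \<open>u\<close> and \<open>w\<close>; and at least \<open>2 * s\<close>
  arcs between \<open>w\<close> and \<open>T\<close>.\<close>

lemma prob_small_dead:
  assumes k: "k < 5" and i: "i < length P" and u: "u \<in> {1..n} - zone s P k" and w: "w \<in> {1..n} - zone s P k"
    and uw: "u \<noteq> w"
  shows "Om {f. core n P s k f \<and> card (nbrs d n f u) < L \<and> orient d u w \<in> arcs1 n f \<and> dead d n P s k f w i}
    \<le> (1 / \<eta>) ^ L * \<alpha> ^ (n - 2) * p1 * \<phi> ^ (2 * s)" (is "Om ?X \<le> ?\<epsilon>")
proof -
  let ?S1 = "orient d u ` ({1..n} - {u, w})"
  define R where "R T f \<longleftrightarrow> card {e \<in> ?S1. fst (f e) = 0} \<le> L \<and> fst (f (orient d u w)) \<le> (1::nat) \<and>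
     (\<forall>x\<in>T. \<not> (fst (f (orient d w x)) = 0 \<and> snd (f (orient d w x)) = P ! i))" for T and f :: "arc \<Rightarrow> nat \<times> nat"
  have out: "orient d u x \<notin> inner_arcs n P s k" "orient d w x \<notin> inner_arcs n P s k" for x
    using u w by (auto simp: inner_arcs_def orient_def)
  have "Om ?X \<le> Om {f. core n P s k f \<and> R (target d n P s k f i) f}"
  proof (intro measure_pmf.finite_measure_mono subsetI CollectI conjI)
    fix f assume f: "f \<in> ?X"
    then show c: "core n P s k f" by simp
    have "{e \<in> ?S1. fst (f e) = 0} \<subseteq> orient d u ` nbrs d n f u" using u by (auto simp: nbrs_def arcs0_def)
    then have "card {e \<in> ?S1. fst (f e) = 0} \<le> card (orient d u ` nbrs d n f u)" by (intro card_mono) auto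
    then have "card {e \<in> ?S1. fst (f e) = 0} \<le> L" using f by (simp add: card_orient_image)
    moreover have "fst (f (orient d u w)) \<le> 1" using f by (simp add: arcs1_def)
    moreover have "\<not> (fst (f (orient d w x)) = 0 \<and> snd (f (orient d w x)) = P ! i)"
      if "x \<in> target d n P s k f i" for x
    proof -
      have "x \<in> zone s P k" using that core_target(1)[OF c s(1) i] by blast
      then have "orient d w x \<in> all_arcs n" using w zone_subset[OF k] by auto
      then show ?thesis using f that by (auto simp: stuck_def arcs0_def)
    qed
    ultimately show "R (target d n P s k f i) f" by (auto simp: R_def)
  qed simp
  also have "\<dots> \<le> ?\<epsilon>"
  proof (rule prob_core_event[OF k i])
    show "0 \<le> ?\<epsilon>" using \<eta> alpha phi p by auto
    show "R T h" if "R T (glue (inner_arcs n P s k) g h)" for T g h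
    proof -
      have "{e \<in> ?S1. fst (glue (inner_arcs n P s k) g h e) = 0} = {e \<in> ?S1. fst (h e) = 0}"
        using out by (auto simp: glue_def)
      then show ?thesis using that out by (simp add: R_def glue_def)
    qed
    fix T assume T: "T \<subseteq> zone s P k" "2 * s \<le> card T"
    let ?A = "all_arcs n - inner_arcs n P s k"
    have wT: "w \<notin> T" "u \<notin> T" "T \<subseteq> {1..n}" using T w u zone_subset[OF k] by auto
    have "measure_pmf.prob (Pi_pmf ?A (0, 0) (\<lambda>_. arc_pmf)) {f. R T f} \<le>
       (1 / \<eta>) ^ L * \<alpha> ^ card ?S1 * p1 ^ card {orient d u w} * \<phi> ^ card (orient d w ` T)"
    proof (rule prob_profile[where c = "P ! i"])
      show "?S1 \<inter> orient d w ` T = {}" "{orient d u w} \<inter> orient d w ` T = {}"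
        using uw wT by (auto simp: orient_def)
      show "?S1 \<subseteq> ?A" "{orient d u w} \<subseteq> ?A" "orient d w ` T \<subseteq> ?A" using out u w uw wT by auto
    qed (use color[OF i] in \<open>auto simp: R_def\<close>)
    also have "card ?S1 = n - 2" using u w uw by (simp add: card_orient_image card_Diff_subset)
    also have "card (orient d w ` T) = card T" by (rule card_orient_image)
    also have "(1 / \<eta>) ^ L * \<alpha> ^ (n - 2) * p1 ^ card {orient d u w} * \<phi> ^ card T \<le> ?\<epsilon>"
      using T(2) \<eta> p alpha phi by (simp, intro mult_left_mono power_decreasing) auto
    finally show "measure_pmf.prob (Pi_pmf ?A (0, 0) (\<lambda>_. arc_pmf)) {f. R T f} \<le> ?\<epsilon>" .
  qed
  finally show ?thesis .
qed

text \<open>The vertices of \<open>W\<close> have disjoint sets of arcs to \<open>T\<close>, also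
  disjoint from the arcs joining them to \<open>u\<close>, so the costs of being a neighbor and of
  being dead multiply over \<open>W\<close>.\<close>

lemma prob_many_dead:
  assumes k: "k < 5" and i: "i < length P" and u: "u \<in> {1..n} - zone s P k" and W: "W \<subseteq> {1..n} - zone s P k"
  shows "Om {f. core n P s k f \<and> W \<subseteq> nbrs d n f u \<and> (\<forall>w\<in>W. dead d n P s k f w i)}
    \<le> p1 ^ card W * \<phi> ^ (2 * s * card W)" (is "Om ?X \<le> ?\<epsilon>")
proof (cases "u \<in> W")
  case True
  then have "?X = {}" using u by (auto simp: nbrs_def arcs0_def)
  moreover have "0 \<le> ?\<epsilon>" using phi p by auto
  ultimately show ?thesis by (simp only: measure_empty)
next
  case False
  define R where "R T f \<longleftrightarrow> (\<forall>w\<in>W. fst (f (orient d u w)) \<le> (1::nat)) \<and>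
     (\<forall>w\<in>W. \<forall>x\<in>T. \<not> (fst (f (orient d w x)) = 0 \<and> snd (f (orient d w x)) = P ! i))" for T and f :: "arc \<Rightarrow> nat \<times> nat"
  have finW: "finite W" using W finite_subset by blast
  have out: "orient d u x \<notin> inner_arcs n P s k" "w \<in> W \<Longrightarrow> orient d w x \<notin> inner_arcs n P s k" for w x
    using u W by (auto simp: inner_arcs_def orient_def)
  have "Om ?X \<le> Om {f. core n P s k f \<and> R (target d n P s k f i) f}"
  proof (intro measure_pmf.finite_measure_mono subsetI CollectI conjI)
    fix f assume f: "f \<in> ?X"
    then show c: "core n P s k f" by simp
    \<comment> \<open>Mark 0 is relaxed to mark at most 1 to fit the profile bound, whence the
      factor \<open>p1\<close>.\<close>
    have "fst (f (orient d u w)) \<le> 1" if "w \<in> W" for w using f that by (auto simp: nbrs_def arcs0_def)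
    moreover have "\<not> (fst (f (orient d w x)) = 0 \<and> snd (f (orient d w x)) = P ! i)"
      if "x \<in> target d n P s k f i" "w \<in> W" for x w
    proof -
      have "x \<in> zone s P k" using that core_target(1)[OF c s(1) i] by blast
      then have "orient d w x \<in> all_arcs n" using that W zone_subset[OF k] by auto
      moreover have "stuck d n P (target d n P s k f i) f w i" using f that by simp
      ultimately show ?thesis using that(1) unfolding stuck_def arcs0_def by blast
    qed
    ultimately show "R (target d n P s k f i) f" by (auto simp: R_def)
  qed simp
  also have "\<dots> \<le> ?\<epsilon>"
  proof (rule prob_core_event[OF k i])
    show "0 \<le> ?\<epsilon>" using phi p by auto
    show "R T h" if "R T (glue (inner_arcs n P s k) g h)" for T g h
      using that out by (simp add: R_def glue_def)
    fix T assume T: "T \<subseteq> zone s P k" "2 * s \<le> card T"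
    let ?A = "all_arcs n - inner_arcs n P s k"
    let ?S3 = "(\<lambda>(w, x). orient d w x) ` (W \<times> T)"
    have wT: "W \<inter> T = {}" "u \<notin> T" "T \<subseteq> {1..n}" using T W u zone_subset[OF k] by auto
    have "measure_pmf.prob (Pi_pmf ?A (0, 0) (\<lambda>_. arc_pmf)) {f. R T f} \<le>
       (1 / \<eta>) ^ 0 * \<alpha> ^ card ({} :: arc set) * p1 ^ card (orient d u ` W) * \<phi> ^ card ?S3"
    proof (rule prob_profile[where c = "P ! i"])
      show "orient d u ` W \<inter> ?S3 = {}" using False wT by (auto simp: orient_def)
      show "orient d u ` W \<subseteq> ?A" using out u W False by auto
      show "?S3 \<subseteq> ?A"
      proof
        fix e assume "e \<in> ?S3"
        then obtain w x where e: "e = orient d w x" "w \<in> W" "x \<in> T" by (elim imageE SigmaE) simp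
        then have "w \<in> {1..n}" "x \<in> {1..n}" "w \<noteq> x" using W wT by blast+
        then show "e \<in> ?A" using e out(2) by simp
      qed
      fix f e assume f: "f \<in> {f. R T f}"
      show "fst (f e) \<le> 1" if "e \<in> orient d u ` W" using f that unfolding R_def by blast
      show "\<not> (fst (f e) = 0 \<and> snd (f e) = P ! i)" if e: "e \<in> ?S3"
      proof -
        from e obtain w x where "e = orient d w x" "w \<in> W" "x \<in> T" by (elim imageE SigmaE) simp
        then show ?thesis using f unfolding R_def by blast
      qed
    qed (use color[OF i] in simp_all)
    also have "card (orient d u ` W) = card W" by (rule card_orient_image)
    also have "card ?S3 = card W * card T"
      by (subst card_image) (auto simp: inj_on_def orient_def card_cartesian_product)
    also have "(1 / \<eta>) ^ 0 * \<alpha> ^ card ({} :: arc set) * p1 ^ card W * \<phi> ^ (card W * card T) \<le> ?\<epsilon>"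
      using T(2) p phi by (simp, intro mult_left_mono power_decreasing) auto
    finally show "measure_pmf.prob (Pi_pmf ?A (0, 0) (\<lambda>_. arc_pmf)) {f. R T f} \<le> ?\<epsilon>" .
  qed
  finally show ?thesis .
qed

text \<open>The arcs leaving \<open>u\<close> and those entering \<open>v\<close> are disjoint once
  \<open>u\<close>, \<open>v\<close>, \<open>w\<close> are omitted as other ends; together at most
  \<open>2 * L\<close> of them have mark 0.\<close>

lemma prob_small_close:
  assumes u: "u \<in> {1..n}" and v: "v \<in> {1..n}" and w: "w \<in> {1..n}" and d: "u \<noteq> v" "u \<noteq> w" "v \<noteq> w"
  shows "Om {f. card (nbrs True n f u) < L \<and> card (nbrs False n f v) < L \<and> (u, w) \<in> arcs1 n f \<and> (w, v) \<in> arcs1 n f}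
    \<le> (1 / \<eta>) ^ (2 * L) * \<alpha> ^ (2 * (n - 3)) * p1 ^ 2" (is "Om ?X \<le> _")
proof -
  let ?V = "{1..n} - {u, v, w}"
  let ?S = "orient True u ` ?V" and ?S' = "orient False v ` ?V"
  have dj: "?S \<inter> ?S' = {}" by (auto simp: orient_def)
  have "Om ?X \<le> (1 / \<eta>) ^ (2 * L) * \<alpha> ^ card (?S \<union> ?S') * p1 ^ card {(u, w), (w, v)} * \<phi> ^ card ({} :: arc set)"
    unfolding omega_Pi
  \<comment> \<open>No color is prescribed here: the third set is empty and \<open>c\<close> is an
    arbitrary color.\<close>
  proof (rule prob_profile[where c = 1])
    show "?S \<union> ?S' \<subseteq> all_arcs n" using u v by auto
    show "{(u, w), (w, v)} \<subseteq> all_arcs n" using u v w d by (auto simp: all_arcs_def)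
    show "(?S \<union> ?S') \<inter> {(u, w), (w, v)} = {}" using d by (auto simp: orient_def)
    fix f assume f: "f \<in> ?X"
    have "{e \<in> ?S \<union> ?S'. fst (f e) = 0} \<subseteq> orient True u ` nbrs True n f u \<union> orient False v ` nbrs False n f v"
      using u v by (auto simp: nbrs_def arcs0_def)
    then have "card {e \<in> ?S \<union> ?S'. fst (f e) = 0} \<le>
        card (orient True u ` nbrs True n f u \<union> orient False v ` nbrs False n f v)" by (intro card_mono) auto
    also have "\<dots> \<le> card (nbrs True n f u) + card (nbrs False n f v)"
      using card_Un_le card_orient_image by metis
    also have "\<dots> \<le> 2 * L" using f by simp
    finally show "card {e \<in> ?S \<union> ?S'. fst (f e) = 0} \<le> 2 * L" .
    show "fst (f e) \<le> 1" if "e \<in> {(u, w), (w, v)}" for e using f that by (auto simp: arcs1_def)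
  qed (use r in auto)
  also have "card (?S \<union> ?S') = 2 * (n - 3)"
    using dj u v w d by (subst card_Un_disjoint) (auto simp: card_orient_image card_Diff_subset)
  also have "card {(u, w), (w, v)} = 2" using d by simp
  finally show ?thesis by simp
qed

text \<open>The out-stars of the vertices partition the arcs, so the events of having an
  out-neighbor along mark 0 are independent and their probabilities multiply.\<close>

lemma prob_no_source: "Om {f. \<forall>u\<in>{1..n}. nbrs True n f u \<noteq> {}} \<le> (1 - (1 - p0) ^ (n - 1)) ^ n"
proof -
  define S where "S u = orient True u ` ({1..n} - {u})" for u
  have U: "(\<Union>u\<in>{1..n}. S u) = all_arcs n" by (auto simp: S_def orient_def all_arcs_def)
  let ?Q = "\<lambda>u (f :: arc \<Rightarrow> nat \<times> nat). \<exists>e\<in>S u. fst (f e) = 0"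
  have p0: "p0 \<le> 1" using p by simp
  have "measure_pmf.prob (Pi_pmf (\<Union>u\<in>{1..n}. S u) (0, 0) (\<lambda>_. arc_pmf)) {f. \<forall>u\<in>{1..n}. ?Q u f} \<le>
     (1 - (1 - p0) ^ (n - 1)) ^ card {1..n}"
  proof (rule prob_Pi_pmf_groups)
    fix u assume u: "u \<in> {1..n}"
    have c: "card (S u) = n - 1" and f: "finite (S u)" using u by (simp_all add: S_def card_orient_image)
    have m: "measure_pmf.prob arc_pmf {y. fst y \<noteq> 0} = 1 - p0"
    proof -
      have "{y. fst y \<noteq> 0} = UNIV - {y :: nat \<times> nat. fst y = 0}" by auto
      then show ?thesis using measure_pmf.prob_compl[of "{y. fst y = 0}" arc_pmf] prob_mark0 by simp
    qed
    let ?M = "measure_pmf.prob (Pi_pmf (S u) (0, 0) (\<lambda>_. arc_pmf))"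
    have "?M (Pi (S u) (\<lambda>_. {y. fst y \<noteq> 0})) = (1 - p0) ^ (n - 1)"
      using measure_Pi_pmf_Pi[OF f, of "(0, 0)" "\<lambda>_. arc_pmf" "\<lambda>_. {y. fst y \<noteq> 0}"] by (simp only: m c prod_constant)
    moreover have "{f. ?Q u f} = UNIV - Pi (S u) (\<lambda>_. {y. fst y \<noteq> 0})"
    proof -
      have "f \<in> Pi (S u) (\<lambda>_. {y. fst y \<noteq> 0}) \<longleftrightarrow> \<not> ?Q u f" for f
      proof
        assume "\<not> ?Q u f"
        then show "f \<in> Pi (S u) (\<lambda>_. {y. fst y \<noteq> 0})" by (intro Pi_I CollectI notI) (erule notE, rule bexI)
      next
        assume f: "f \<in> Pi (S u) (\<lambda>_. {y. fst y \<noteq> 0})"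
        show "\<not> ?Q u f"
        proof
          assume "?Q u f"
          then obtain e where "e \<in> S u" "fst (f e) = 0" ..
          then show False using Pi_mem[OF f, of e] by simp
        qed
      qed
      then show ?thesis by blast
    qed
    ultimately show "?M {f. ?Q u f} \<le> 1 - (1 - p0) ^ (n - 1)"
      using measure_pmf.prob_compl[of "Pi (S u) (\<lambda>_. {y. fst y \<noteq> 0})" "Pi_pmf (S u) (0, 0) (\<lambda>_. arc_pmf)"] by simp
  next
    show "disjoint_family_on S {1..n}" by (auto simp: disjoint_family_on_def S_def orient_def)
    show "0 \<le> 1 - (1 - p0) ^ (n - 1)" using p p0 by (simp add: power_le_one)
    show "?Q u g" if eq: "\<And>e. e \<in> S u \<Longrightarrow> f e = g e" and Q: "?Q u f" for u f g
    proof -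
      from Q obtain e where "e \<in> S u" "fst (f e) = 0" ..
      then show ?thesis using eq[of e] by (intro bexI[of _ e]) simp_all
    qed
  qed (auto simp: S_def)
  moreover have "Om {f. \<forall>u\<in>{1..n}. nbrs True n f u \<noteq> {}} \<le> Om {f. \<forall>u\<in>{1..n}. ?Q u f}"
  proof (intro measure_pmf.finite_measure_mono subsetI CollectI ballI)
    fix f u assume "f \<in> {f. \<forall>u\<in>{1..n}. nbrs True n f u \<noteq> {}}" "u \<in> {1..n}"
    then obtain x where "orient True u x \<in> arcs0 n f" unfolding nbrs_def by blast
    then have "orient True u x \<in> S u" "fst (f (orient True u x)) = 0" by (auto simp: S_def arcs0_def)
    then show "?Q u f" by blast
  qed simp
  ultimately show ?thesis unfolding U omega_Pi by simp
qed

lemma prob_isolated: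
  assumes u: "u \<in> {1..n}"
  shows "Om {f. \<forall>x. orient d u x \<notin> arcs1 n f} \<le> (1 - p1) ^ (n - 1)"
proof -
  let ?S = "orient d u ` ({1..n} - {u})"
  let ?B = "\<lambda>e. if e \<in> ?S then {y. \<not> fst y \<le> 1} else UNIV"
  have S: "?S \<subseteq> all_arcs n" using u by auto
  have m: "measure_pmf.prob arc_pmf {y. \<not> fst y \<le> 1} = 1 - p1"
  proof -
    have "{y. \<not> fst y \<le> 1} = UNIV - {y :: nat \<times> nat. fst y \<le> 1}" by auto
    then show ?thesis using measure_pmf.prob_compl[of "{y. fst y \<le> 1}" arc_pmf] prob_mark1 by simp
  qed
  have "Om {f. \<forall>x. orient d u x \<notin> arcs1 n f} \<le> Om (Pi (all_arcs n) ?B)"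
  proof (intro measure_pmf.finite_measure_mono subsetI)
    fix f assume f: "f \<in> {f. \<forall>x. orient d u x \<notin> arcs1 n f}"
    have "f e \<in> ?B e" if "e \<in> all_arcs n" for e using f that unfolding arcs1_def by fastforce
    then show "f \<in> Pi (all_arcs n) ?B" by blast
  qed simp
  also have "\<dots> = (\<Prod>e\<in>all_arcs n. measure_pmf.prob arc_pmf (?B e))"
    unfolding omega_Pi by (rule measure_Pi_pmf_Pi) simp
  also have "\<dots> = (\<Prod>e\<in>?S. 1 - p1)"
    using S m by (intro prod.mono_neutral_cong_right) auto
  also have "\<dots> = (1 - p1) ^ (n - 1)" using u by (simp add: card_orient_image)
  finally show ?thesis .
qed

end

section \<open>Union bound over the exceptional events\<close>

context zone_model
begin

text \<open>The summands correspond, in order, to the six conjuncts of \<open>typical\<close>. The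
  factor 10 counts two orientations and five zones, and \<open>n ^ K\<close> bounds the number of
  sets of \<open>K\<close> neighbors.\<close>

lemma prob_not_typical:
  "Om {f. \<not> typical n P s K L f} \<le>
     5 * (length P * 2 ^ (8 * s) * \<phi> ^ (s * s - s)) +
     10 * length P * n ^ 2 * ((1 / \<eta>) ^ L * \<alpha> ^ (n - 2) * p1 * \<phi> ^ (2 * s)) +
     10 * length P * n * n ^ K * (p1 ^ K * \<phi> ^ (2 * s * K)) +
     n ^ 3 * ((1 / \<eta>) ^ (2 * L) * \<alpha> ^ (2 * (n - 3)) * p1 ^ 2) +
     (1 - (1 - p0) ^ (n - 1)) ^ n + 2 * n * (1 - p1) ^ (n - 1)"
proof -
  let ?l = "length P"
  let ?Q1 = "\<lambda>k f. \<not> core n P s k f"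
  let ?Q2 = "\<lambda>(d, k, i, u, w) f. core n P s k f \<and> card (nbrs d n f u) < L \<and> orient d u w \<in> arcs1 n f \<and> dead d n P s k f w i"
  let ?Q3 = "\<lambda>(d, k, i, u, W) f. core n P s k f \<and> W \<subseteq> nbrs d n f u \<and> (\<forall>w\<in>W. dead d n P s k f w i)"
  let ?Q4 = "\<lambda>(u, v, w) f. card (nbrs True n f u) < L \<and> card (nbrs False n f v) < L \<and> (u, w) \<in> arcs1 n f \<and> (w, v) \<in> arcs1 n f"
  let ?Q5 = "\<lambda>f. \<forall>u\<in>{1..n}. nbrs True n f u \<noteq> {}"
  let ?Q6 = "\<lambda>(d, u) f. \<forall>x. orient d u x \<notin> arcs1 n f"
  define J2 where "J2 = (UNIV :: bool set) \<times> {..<5::nat} \<times> {..<?l} \<times> {1..n} \<times> {1..n}"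
  define I2 where "I2 = {(d, k, i, u, w) \<in> J2. u \<notin> zone s P k \<and> w \<notin> zone s P k \<and> u \<noteq> w}"
  define J3 where "J3 = (UNIV :: bool set) \<times> {..<5::nat} \<times> {..<?l} \<times> {1..n} \<times> {W. W \<subseteq> {1..n} \<and> card W = K}"
  define I3 where "I3 = {(d, k, i, u, W) \<in> J3. u \<notin> zone s P k \<and> W \<subseteq> {1..n} - zone s P k}"
  define J4 where "J4 = {1..n} \<times> {1..n} \<times> {1..n}"
  define I4 where "I4 = {(u, v, w) \<in> J4. u \<noteq> v \<and> u \<noteq> w \<and> v \<noteq> w}"
  define J6 where "J6 = (UNIV :: bool set) \<times> {1..n}"
  have nonneg: "0 \<le> \<phi>" "0 \<le> \<alpha>" "0 \<le> 1 / \<eta>" "0 \<le> p1" "0 \<le> 1 - p1" using phi alpha \<eta> p by auto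

  have b1: "Om {f. \<exists>k\<in>{..<5}. ?Q1 k f} \<le> card {..<5::nat} * (?l * 2 ^ (8 * s) * \<phi> ^ (s * s - s))"
    by (rule prob_Ex_le) (use prob_not_core in auto)

  have b2: "Om {f. \<exists>j\<in>I2. ?Q2 j f} \<le> card J2 * ((1 / \<eta>) ^ L * \<alpha> ^ (n - 2) * p1 * \<phi> ^ (2 * s))"
  proof (rule prob_Ex_index_le)
    show "I2 \<subseteq> J2" "finite J2" by (auto simp: I2_def J2_def)
    show "0 \<le> (1 / \<eta>) ^ L * \<alpha> ^ (n - 2) * p1 * \<phi> ^ (2 * s)"
      by (intro mult_nonneg_nonneg zero_le_power nonneg)
    fix j assume j: "j \<in> I2"
    obtain d k i u w where j': "j = (d, k, i, u, w)" by (cases j)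
    have "k < 5" "i < ?l" "u \<in> {1..n} - zone s P k" "w \<in> {1..n} - zone s P k" "u \<noteq> w"
      using j by (simp_all add: j' I2_def J2_def)
    from prob_small_dead[OF this, of d L]
    show "Om {f. ?Q2 j f} \<le> (1 / \<eta>) ^ L * \<alpha> ^ (n - 2) * p1 * \<phi> ^ (2 * s)" by (simp add: j')
  qed
  have c2: "card J2 = 10 * ?l * n ^ 2" by (simp add: J2_def card_cartesian_product power2_eq_square card_UNIV_bool)

  have b3: "Om {f. \<exists>j\<in>I3. ?Q3 j f} \<le> card J3 * (p1 ^ K * \<phi> ^ (2 * s * K))"
  proof (rule prob_Ex_index_le)
    show "I3 \<subseteq> J3" "finite J3" by (auto simp: I3_def J3_def)
    show "0 \<le> p1 ^ K * \<phi> ^ (2 * s * K)"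
      by (intro mult_nonneg_nonneg zero_le_power nonneg)
    fix j assume j: "j \<in> I3"
    obtain d k i u W where j': "j = (d, k, i, u, W)" by (cases j)
    have "k < 5" "i < ?l" "u \<in> {1..n} - zone s P k" "W \<subseteq> {1..n} - zone s P k" and c: "card W = K"
      using j by (simp_all add: j' I3_def J3_def)
    from prob_many_dead[OF this(1-4), of d] c
    show "Om {f. ?Q3 j f} \<le> p1 ^ K * \<phi> ^ (2 * s * K)" by (simp add: j')
  qed
  have c3: "card J3 \<le> 10 * ?l * n * n ^ K"
  proof -
    have "n choose K \<le> n ^ K"
      by (cases "K \<le> n") (auto simp: binomial_le_pow binomial_eq_0)
    then show ?thesis
      by (simp add: J3_def card_cartesian_product n_subsets card_UNIV_bool)
  qed

  have b4: "Om {f. \<exists>j\<in>I4. ?Q4 j f} \<le> card J4 * ((1 / \<eta>) ^ (2 * L) * \<alpha> ^ (2 * (n - 3)) * p1 ^ 2)"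
  proof (rule prob_Ex_index_le)
    show "I4 \<subseteq> J4" "finite J4" by (auto simp: I4_def J4_def)
    show "0 \<le> (1 / \<eta>) ^ (2 * L) * \<alpha> ^ (2 * (n - 3)) * p1 ^ 2"
      by (intro mult_nonneg_nonneg zero_le_power nonneg)
    fix j assume j: "j \<in> I4"
    obtain u v w where j': "j = (u, v, w)" by (cases j)
    have "u \<in> {1..n}" "v \<in> {1..n}" "w \<in> {1..n}" "u \<noteq> v" "u \<noteq> w" "v \<noteq> w"
      using j by (simp_all add: j' I4_def J4_def)
    from prob_small_close[OF this, of L]
    show "Om {f. ?Q4 j f} \<le> (1 / \<eta>) ^ (2 * L) * \<alpha> ^ (2 * (n - 3)) * p1 ^ 2" by (simp add: j')
  qed
  have c4: "card J4 = n ^ 3" by (simp add: J4_def card_cartesian_product power3_eq_cube)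

  have b6: "Om {f. \<exists>j\<in>J6. ?Q6 j f} \<le> card J6 * (1 - p1) ^ (n - 1)"
  proof (rule prob_Ex_le)
    show "finite J6" by (simp add: J6_def)
    fix j assume j: "j \<in> J6"
    obtain d u where j': "j = (d, u)" by (cases j)
    have "u \<in> {1..n}" using j by (simp add: j' J6_def)
    from prob_isolated[OF this, of d] show "Om {f. ?Q6 j f} \<le> (1 - p1) ^ (n - 1)" by (simp add: j')
  qed
  have c6: "card J6 = 2 * n" by (simp add: J6_def card_cartesian_product card_UNIV_bool)

  let ?E1 = "\<lambda>f. \<exists>k\<in>{..<5}. ?Q1 k f" and ?E2 = "\<lambda>f. \<exists>j\<in>I2. ?Q2 j f" and ?E3 = "\<lambda>f. \<exists>j\<in>I3. ?Q3 j f"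
    and ?E4 = "\<lambda>f. \<exists>j\<in>I4. ?Q4 j f" and ?E6 = "\<lambda>f. \<exists>j\<in>J6. ?Q6 j f"
  have cover: "typical n P s K L f"
    if "\<not> ?E1 f" "\<not> ?E2 f" "\<not> ?E3 f" "\<not> ?E4 f" "\<not> ?Q5 f" "\<not> ?E6 f" for f
    unfolding typical_def
  proof (intro conjI allI ballI impI)
    fix k :: nat assume k: "k < 5"
    then show c: "core n P s k f" using that(1) by blast
    fix d i u w assume *: "i < ?l" "u \<in> {1..n} - zone s P k" "w \<in> {1..n} - zone s P k" "u \<noteq> w"
      "card (nbrs d n f u) < L" "orient d u w \<in> arcs1 n f"
    have "(d, k, i, u, w) \<in> I2" using k * by (simp add: I2_def J2_def)
    then have "\<not> ?Q2 (d, k, i, u, w) f" using that(2) by blast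
    then show "\<not> dead d n P s k f w i" using c * by simp
  next
    fix d and k :: nat and i u assume k: "k < 5" and *: "i < ?l" "u \<in> {1..n} - zone s P k"
    show "card {w \<in> nbrs d n f u - zone s P k. dead d n P s k f w i} < K"
    proof (rule ccontr)
      assume "\<not> ?thesis"
      then have "K \<le> card {w \<in> nbrs d n f u - zone s P k. dead d n P s k f w i}" by simp
      then obtain W where W: "W \<subseteq> {w \<in> nbrs d n f u - zone s P k. dead d n P s k f w i}" "card W = K"
        by (rule obtain_subset_with_card_n)
      have "nbrs d n f u \<subseteq> {1..n}" by (auto simp: nbrs_def arcs0_def)
      then have "W \<subseteq> {1..n} - zone s P k" using W(1) by blast
      then have "(d, k, i, u, W) \<in> I3" using k * W(2) by (auto simp: I3_def J3_def)
      then have "\<not> ?Q3 (d, k, i, u, W) f" using that(3) by blast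
      moreover have "core n P s k f" using that(1) k by blast
      moreover have "W \<subseteq> nbrs d n f u" "\<forall>w\<in>W. dead d n P s k f w i" using W(1) by blast+
      ultimately show False by simp
    qed
  next
    fix u v w assume *: "u \<in> {1..n}" "v \<in> {1..n}" "w \<in> {1..n}" "u \<noteq> v" "u \<noteq> w" "v \<noteq> w"
      "card (nbrs True n f u) < L" "card (nbrs False n f v) < L" "(u, w) \<in> arcs1 n f"
    have "(u, v, w) \<in> I4" using * by (simp add: I4_def J4_def)
    then have "\<not> ?Q4 (u, v, w) f" using that(4) by blast
    then show "(w, v) \<notin> arcs1 n f" using * by simp
  next
    show "\<exists>u\<in>{1..n}. nbrs True n f u = {}" using that(5) by blast
  next
    fix d u assume "u \<in> {1..n}"
    then have "(d, u) \<in> J6" by (simp add: J6_def)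
    then have "\<not> ?Q6 (d, u) f" using that(6) by blast
    then show "\<exists>x. orient d u x \<in> arcs1 n f" by simp
  qed
  have "Om {f. \<not> typical n P s K L f} \<le> Om {f. ?E1 f \<or> ?E2 f \<or> ?E3 f \<or> ?E4 f \<or> ?Q5 f \<or> ?E6 f}"
    by (rule measure_pmf.finite_measure_mono) (use cover in \<open>blast, simp\<close>)
  also have "\<dots> \<le> Om {f. ?E1 f} + Om {f. ?E2 f \<or> ?E3 f \<or> ?E4 f \<or> ?Q5 f \<or> ?E6 f}" by (rule prob_disj_le)
  also have "Om {f. ?E2 f \<or> ?E3 f \<or> ?E4 f \<or> ?Q5 f \<or> ?E6 f} \<le> Om {f. ?E2 f} + Om {f. ?E3 f \<or> ?E4 f \<or> ?Q5 f \<or> ?E6 f}"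
    by (rule prob_disj_le)
  also have "Om {f. ?E3 f \<or> ?E4 f \<or> ?Q5 f \<or> ?E6 f} \<le> Om {f. ?E3 f} + Om {f. ?E4 f \<or> ?Q5 f \<or> ?E6 f}"
    by (rule prob_disj_le)
  also have "Om {f. ?E4 f \<or> ?Q5 f \<or> ?E6 f} \<le> Om {f. ?E4 f} + Om {f. ?Q5 f \<or> ?E6 f}" by (rule prob_disj_le)
  also have "Om {f. ?Q5 f \<or> ?E6 f} \<le> Om {f. ?Q5 f} + Om {f. ?E6 f}" by (rule prob_disj_le)
  finally have sum: "Om {f. \<not> typical n P s K L f} \<le>
    Om {f. ?E1 f} + (Om {f. ?E2 f} + (Om {f. ?E3 f} + (Om {f. ?E4 f} + (Om {f. ?Q5 f} + Om {f. ?E6 f}))))"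
    by simp
  have b3': "Om {f. ?E3 f} \<le> real (10 * ?l * n * n ^ K) * (p1 ^ K * \<phi> ^ (2 * s * K))"
    by (rule order_trans[OF b3]) (intro mult_right_mono of_nat_mono c3 mult_nonneg_nonneg zero_le_power nonneg)
  show ?thesis
    using sum b1 b2[unfolded c2] b3' b4[unfolded c4] prob_no_source b6[unfolded c6] by simp
qed

end

section \<open>Hitting times in a typical configuration\<close>

lemma pattern_connected_cong:
  assumes "pattern_connected P (dg n F) c" "\<And>e. e \<in> F \<Longrightarrow> c e = c' e"
  shows "pattern_connected P (dg n F) c'"
  unfolding pattern_connected_def
proof (intro ballI impI)
  fix u v assume "u \<in> verts (dg n F)" "v \<in> verts (dg n F)" "u \<noteq> v"
  then obtain p where p: "pre_digraph.apath (dg n F) u p v" "pattern_colored P c p"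
    using assms(1) unfolding pattern_connected_def by blast
  have "set p \<subseteq> F" using p(1) by (simp add: pre_digraph.apath_def pre_digraph.awalk_def)
  then have "c (p ! j) = c' (p ! j)" if "j < length p" for j using assms(2) that nth_mem by blast
  then have "pattern_colored P c' p" using p(2) unfolding pattern_colored_def by auto
  then show "\<exists>p. pre_digraph.apath (dg n F) u p v \<and> pattern_colored P c' p" using p(1) by blast
qed

lemma degree_ge_1:
  assumes "finite F"
  shows "in_degree (dg n F) v \<ge> 1 \<longleftrightarrow> (\<exists>x. orient False v x \<in> F)"
    "out_degree (dg n F) v \<ge> 1 \<longleftrightarrow> (\<exists>x. orient True v x \<in> F)"
proof -
  have 1: "1 \<le> card X \<longleftrightarrow> X \<noteq> {}" if "finite X" for X :: "arc set"
    using that by (metis card_gt_0_iff One_nat_def Suc_le_eq)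
  have "in_arcs (dg n F) v = {e \<in> F. snd e = v}" "out_arcs (dg n F) v = {e \<in> F. fst e = v}"
    by (auto simp: in_arcs_def out_arcs_def)
  then show "in_degree (dg n F) v \<ge> 1 \<longleftrightarrow> (\<exists>x. orient False v x \<in> F)"
    "out_degree (dg n F) v \<ge> 1 \<longleftrightarrow> (\<exists>x. orient True v x \<in> F)"
    using assms by (auto simp: in_degree_def out_degree_def 1 orient_def)
qed

text \<open>A path from \<open>u\<close> to another vertex begins with an arc out of
  \<open>u\<close>, and a path to \<open>u\<close> ends with an arc into it.\<close>

lemma pattern_connected_imp_degrees:
  assumes "pattern_connected P (dg n F) c" "n \<ge> 2" "u \<in> {1..n}"
  shows "\<exists>x. orient d u x \<in> F"
proof -
  define v :: nat where "v = (if u = 1 then 2 else 1)"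
  have v: "v \<in> {1..n}" "u \<noteq> v" using assms by (auto simp: v_def)
  show ?thesis
  proof (cases d)
    case True
    obtain p where p: "pre_digraph.apath (dg n F) u p v"
      using assms(1)[unfolded pattern_connected_def, rule_format, of u v] assms(3) v by auto
    then have "set p \<subseteq> F" "pre_digraph.cas (dg n F) u p v"
      by (simp_all add: pre_digraph.apath_def pre_digraph.awalk_def)
    then show ?thesis using v True
      by (cases p) (auto simp: pre_digraph.cas.simps orient_def)
  next
    case False
    obtain p where p: "pre_digraph.apath (dg n F) v p u"
      using assms(1)[unfolded pattern_connected_def, rule_format, of v u] assms(3) v by auto
    then have *: "set p \<subseteq> F" "pre_digraph.cas (dg n F) v p u"
      by (simp_all add: pre_digraph.apath_def pre_digraph.awalk_def)
    \<comment> \<open>The start \<open>y\<close> is generalized so that the induction on the walk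
      can descend to its last arc.\<close>
    have "pre_digraph.cas (dg n F) y q u \<Longrightarrow> y \<noteq> u \<Longrightarrow> set q \<subseteq> F \<Longrightarrow> \<exists>x. (x, u) \<in> F" for y q
      by (induction q arbitrary: y) (fastforce simp: pre_digraph.cas.simps)+
    then show ?thesis using * v(2) False by (auto simp: orient_def)
  qed
qed

text \<open>The degree condition \<open>Q\<close> is monotone, fails at \<open>a\<close> and holds
  at \<open>b\<close>, so the arcs at its hitting time \<open>t\<close> lie between the two
  thresholds and the digraph is already connected. Connectivity implies \<open>Q\<close>, so it
  cannot occur before \<open>t\<close>.\<close>

lemma typical_tau:
  assumes tp: "typical n P s K L f" and L: "L = 2 * (length P * K + 2)" and s: "s > 0" and n: "n \<ge> 2"
    and full: "fst ` set h = all_arcs n" and col: "\<And>e. e \<in> all_arcs n \<Longrightarrow> coloring h e = snd (f e)"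
    and colP: "\<And>e. e \<in> all_arcs n \<Longrightarrow> snd (f e) \<in> set P"
    and a: "arcs0 n f = fst ` set (take a h)" and b: "arcs1 n f = fst ` set (take b h)"
  shows "tau_connected P n h = tau_1 n h"
proof -
  let ?F = "\<lambda>i. fst ` set (take i h)"
  have D: "D n h i = dg n (?F i)" for i by (simp add: D_def)
  have mono: "?F i \<subseteq> ?F j" if "i \<le> j" for i j using set_take_subset_set_take[OF that] by (rule image_mono)
  have sub: "?F i \<subseteq> all_arcs n" for i using full set_take_subset[of i h] by blast
  define Q where "Q i \<longleftrightarrow> (\<forall>v\<in>{1..n}. \<forall>d. \<exists>x. orient d v x \<in> ?F i)" for i
  define R where "R i \<longleftrightarrow> pattern_connected P (D n h i) (coloring h)" for i
  have Q: "(\<forall>v\<in>verts (D n h i). in_degree (D n h i) v \<ge> 1 \<and> out_degree (D n h i) v \<ge> 1) \<longleftrightarrow> Q i" for i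
    unfolding D Q_def by (simp add: degree_ge_1 all_bool_eq conj_commute)
  have tau1: "tau_1 n h = (LEAST i. Q i)" by (simp only: tau_1_def Q)
  have tauc: "tau_connected P n h = (LEAST i. R i)" by (simp add: tau_connected_def R_def)
  define t where "t = (LEAST i. Q i)"
  have "Q b" using typicalD(6)[OF tp] by (simp add: Q_def b)
  then have Qt: "Q t" and tb: "t \<le> b" unfolding t_def by (auto intro: LeastI Least_le)
  have "\<not> Q a" using typicalD(5)[OF tp] by (force simp: Q_def a[symmetric] nbrs_def)
  then have at: "a \<le> t" using Qt mono[of t a] unfolding Q_def by (metis nat_le_linear subsetD)
  have "pattern_connected P (dg n (?F t)) (\<lambda>e. snd (f e))"
  proof (rule typical_connected[OF tp L s])
    show "arcs0 n f \<subseteq> ?F t" "?F t \<subseteq> arcs1 n f" using mono[OF at] mono[OF tb] by (simp_all only: a b)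
    show "\<exists>x. orient d u x \<in> ?F t" if "u \<in> {1..n}" for d u using Qt that unfolding Q_def by blast
    show "snd (f e) \<in> set P" if "e \<in> ?F t" for e using that sub colP by blast
  qed
  then have "R t" unfolding R_def D
  proof (rule pattern_connected_cong)
    fix e assume "e \<in> ?F t"
    then have "e \<in> all_arcs n" using sub by blast
    then show "snd (f e) = coloring h e" by (simp only: col)
  qed
  moreover have RQ: "Q i" if "R i" for i
    using pattern_connected_imp_degrees[OF _ n] that unfolding R_def D Q_def by blast
  ultimately have "(LEAST i. R i) = t"
    using Least_le[of Q] by (intro antisym Least_le) (auto simp: t_def intro: LeastI)
  then show ?thesis by (simp add: tau1 tauc t_def)
qed

section \<open>Asymptotics\<close>

lemma one_minus_power_le_exp: "0 \<le> x \<Longrightarrow> x \<le> 1 \<Longrightarrow> (1 - x :: real) ^ m \<le> exp (- (x * m))"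
proof -
  assume x: "0 \<le> x" "x \<le> 1"
  have "(1 - x) ^ m \<le> exp (- x) ^ m" using x exp_ge_add_one_self[of "- x"] by (intro power_mono) auto
  also have "\<dots> = exp (- (x * m))" by (simp add: exp_of_nat_mult[symmetric] mult.commute)
  finally show ?thesis .
qed

text \<open>The six summands of \<open>prob_not_typical\<close>, in order, after the parameters are
  inserted, with powers of \<open>n\<close> written as exponentials of \<open>ln n\<close>.\<close>

definition failure_bound :: "real \<Rightarrow> nat \<Rightarrow> nat \<Rightarrow> nat \<Rightarrow> real \<Rightarrow> nat \<Rightarrow> nat \<Rightarrow> real" where
  "failure_bound \<gamma> l K L \<eta> r n =
     5 * l * 2 ^ n * exp (- (ln n * n / (6400 * l\<^sup>2 * r))) +
     20 * l * (1 / \<eta>) ^ L * exp 2 * ln n * exp (- (\<gamma> / 2 * ln n)) +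
     10 * l * (2 * ln n) ^ K * exp (- ln n) +
     4 * (1 / \<eta>) ^ (2 * L) * exp 6 * (ln n)\<^sup>2 * exp (- (ln n / 2)) +
     exp (- exp (\<eta> * ln n - 2)) +
     2 * exp 2 * exp (- ln n)"

lemma failure_bound_tendsto:
  assumes "\<gamma> > 0" "l > 0" "r > 0" "\<eta> > 0"
  shows "failure_bound \<gamma> l K L \<eta> r \<longlonglongrightarrow> 0"
proof -
  define c where "c = 1 / (6400 * (real l)\<^sup>2 * real r)"
  have c: "c > 0" using assms by (simp add: c_def)
  \<comment> \<open>In the exponent, \<open>n * ln n\<close> outgrows
    \<open>n * ln 2\<close>.\<close>
  have 1: "(\<lambda>n. 2 ^ n * exp (- (c * ln (real n) * n))) \<longlonglongrightarrow> 0" using c by real_asymp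
  have 2: "(\<lambda>n. ln (real n) * exp (- (\<gamma> / 2 * ln (real n)))) \<longlonglongrightarrow> 0" using assms by real_asymp
  have 3: "(\<lambda>n. (2 * ln (real n)) ^ K * exp (- ln (real n))) \<longlonglongrightarrow> 0" by real_asymp
  have 4: "(\<lambda>n. (ln (real n))\<^sup>2 * exp (- (ln (real n) / 2))) \<longlonglongrightarrow> 0" by real_asymp
  have 5: "(\<lambda>n. exp (- exp (\<eta> * ln (real n) - 2))) \<longlonglongrightarrow> 0" using assms by real_asymp
  have 6: "(\<lambda>n. exp (- ln (real n))) \<longlonglongrightarrow> 0" by real_asymp
  have "(\<lambda>n. 5 * real l * (2 ^ n * exp (- (c * ln (real n) * n))) +
     20 * real l * (1 / \<eta>) ^ L * exp 2 * (ln (real n) * exp (- (\<gamma> / 2 * ln (real n)))) +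
     10 * real l * ((2 * ln (real n)) ^ K * exp (- ln (real n))) +
     4 * (1 / \<eta>) ^ (2 * L) * exp 6 * ((ln (real n))\<^sup>2 * exp (- (ln (real n) / 2))) +
     exp (- exp (\<eta> * ln (real n) - 2)) + 2 * exp 2 * exp (- ln (real n))) \<longlonglongrightarrow>
     5 * real l * 0 + 20 * real l * (1 / \<eta>) ^ L * exp 2 * 0 + 10 * real l * 0 + 4 * (1 / \<eta>) ^ (2 * L) * exp 6 * 0 + 0 + 2 * exp 2 * 0"
    by (intro tendsto_add tendsto_mult tendsto_const 1 2 3 4 5 6)
  then show ?thesis by (simp add: failure_bound_def[abs_def] c_def mult.assoc)
qed

text \<open>\<open>\<gamma>\<close> is the exponent with
  \<open>\<phi> ^ (2 * s) \<le> n powr (- \<gamma>)\<close>. As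
  \<open>\<eta> = \<gamma> / 4\<close>, the loss \<open>2 * \<eta>\<close> from small degrees costs
  only half of it. \<open>K = 2 / \<gamma>\<close> makes \<open>K\<close> dead neighbors cost
  \<open>n powr (-2)\<close>, which beats the choice of \<open>u\<close>.\<close>

lemma (in zone_model) prob_not_typical_le_failure_bound:
  fixes \<gamma> x :: real
  defines "x \<equiv> ln n"
  assumes \<gamma>: "\<gamma> = 1 / (40 * length P * r)" "\<eta> = \<gamma> / 4" and K: "K = 80 * length P * r"
    and p0: "p0 = (1 - \<eta>) * x / n" and p1: "p1 = 2 * x / n"
    and large: "n \<le> 40 * length P * s" "s \<ge> 2" "x\<^sup>2 \<le> n" "x \<ge> 1" "p0 \<le> 1 / 2"
  shows "Om {f. \<not> typical n P s K L f} \<le> failure_bound \<gamma> (length P) K L \<eta> r n"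
proof -
  define l where "l = real (length P)"
  define N where "N = real n"
  have l: "l \<ge> 1" using P(2) by (cases P) (simp_all add: l_def)
  have R: "real r \<ge> 1" using r by simp
  have lr: "l * r \<ge> 1" using l R mult_mono[of 1 l 1 "real r"] by simp
  have N: "N \<ge> 20" using n2 by (simp add: N_def)
  have expx: "exp x = N" using N by (simp add: x_def N_def)
  have \<gamma>lr: "\<gamma> = 1 / (40 * (l * r))" by (simp add: \<gamma>(1) l_def)
  have g: "0 < \<gamma>" "\<gamma> \<le> 1 / 40" using lr by (simp_all add: \<gamma>lr field_simps)
  have x0: "x > 0" using large by simp
  have "x * 1 \<le> x * x" using large by (intro mult_left_mono) auto
  moreover have xN2: "x * x \<le> N" using large(3) by (simp add: power2_eq_square N_def)
  ultimately have xN: "x \<le> N" "x\<^sup>2 \<le> N" by (simp_all add: power2_eq_square)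
  have sl: "N \<le> 40 * l * s"
  proof -
    have "real n \<le> real (40 * length P * s)" using large(1) by (simp only: of_nat_le_iff)
    then show ?thesis by (simp add: N_def l_def)
  qed
  have eta_sq: "(1 - \<eta>)\<^sup>2 \<ge> 1 - 2 * \<eta>" "(1 - \<eta>)\<^sup>2 \<le> 1" "1 - \<eta> \<ge> 1 / 2"
    using g \<gamma>(2) by (simp_all add: power2_eq_square algebra_simps mult_left_le)
  have p0N: "p0 * N = (1 - \<eta>) * x" and p1N: "p1 * N = 2 * x" using N by (simp_all add: p0 p1 N_def)
  have phi_pow: "\<phi> ^ m \<le> exp (- (p0 / r * m))" for m
    using one_minus_power_le_exp[of "p0 / r" m] phi by simp
  have alpha_pow: "\<alpha> ^ m \<le> exp (- ((1 - \<eta>) * p0 * m))" for m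
    using one_minus_power_le_exp[of "(1 - \<eta>) * p0" m] alpha by simp

  have t1: "5 * (length P * 2 ^ (8 * s) * \<phi> ^ (s * s - s)) \<le> 5 * l * 2 ^ n * exp (- (x * N / (6400 * l\<^sup>2 * r)))"
  proof -
    have "8 \<le> 20 * length P" using P(2) by (cases P) simp_all
    then have "8 * s \<le> 20 * length P * s" by (rule mult_le_mono1)
    then have "8 * s \<le> n" using s(2) by (rule order_trans)
    then have pow: "(2::real) ^ (8 * s) \<le> 2 ^ n" by (intro power_increasing) simp_all
    have "(N / (40 * l))\<^sup>2 \<le> (real s)\<^sup>2"
      using sl l N by (intro power_mono) (simp_all add: field_simps)
    moreover have "2 * real s \<le> (real s)\<^sup>2" using large(2) by (simp add: power2_eq_square)
    moreover have "real (s * s - s) = (real s)\<^sup>2 - real s"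
      by (subst of_nat_diff) (simp_all add: power2_eq_square)
    \<comment> \<open>\<open>s \<ge> 2\<close> gives \<open>s * s - s \<ge> s * s / 2\<close>. The
      constant 6400 below is \<open>4 * 40 * 40\<close>: one 2 from here, another from
      \<open>1 - \<eta> \<ge> 1 / 2\<close>.\<close>
    ultimately have m: "(N / (40 * l))\<^sup>2 / 2 \<le> real (s * s - s)" by simp
    have "x * N / (6400 * l\<^sup>2 * r) = (x / 2) / N / r * ((N / (40 * l))\<^sup>2 / 2)"
      using N l by (simp add: power2_eq_square field_simps)
    also have "\<dots> \<le> p0 / r * (s * s - s)"
    proof (rule mult_mono[OF _ m])
      have "x / 2 \<le> (1 - \<eta>) * x" using eta_sq(3) x0 by simp
      then show "x / 2 / N / r \<le> p0 / r" unfolding p0 N_def using R by (intro divide_right_mono) simp_all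
    qed (use p in simp_all)
    finally have "\<phi> ^ (s * s - s) \<le> exp (- (x * N / (6400 * l\<^sup>2 * r)))"
      by (intro order_trans[OF phi_pow]) simp
    then have "2 ^ (8 * s) * \<phi> ^ (s * s - s) \<le> 2 ^ n * exp (- (x * N / (6400 * l\<^sup>2 * r)))"
      using pow phi by (intro mult_mono) simp_all
    then have "5 * l * (2 ^ (8 * s) * \<phi> ^ (s * s - s)) \<le> 5 * l * (2 ^ n * exp (- (x * N / (6400 * l\<^sup>2 * r))))"
      using l by (intro mult_left_mono) simp_all
    then show ?thesis by (simp only: mult.assoc of_nat_mult of_nat_power of_nat_numeral l_def)
  qed

  have phi2s: "\<phi> ^ (2 * s) \<le> exp (- (\<gamma> * x))"
  proof -
    have "\<gamma> * x = (x / 2) / N / r * (2 * (N / (40 * l)))"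
      using N l by (simp add: \<gamma>lr field_simps)
    also have "\<dots> \<le> p0 / r * (2 * s)"
    proof (rule mult_mono)
      have "x / 2 \<le> (1 - \<eta>) * x" using eta_sq(3) x0 by simp
      then show "x / 2 / N / r \<le> p0 / r" unfolding p0 N_def using R by (intro divide_right_mono) simp_all
      show "2 * (N / (40 * l)) \<le> real (2 * s)" using sl l by (simp add: field_simps)
    qed (use p N l in simp_all)
    finally show ?thesis by (intro order_trans[OF phi_pow]) simp
  qed

  \<comment> \<open>The full exponent would be \<open>(1 - \<eta>)\<^sup>2 * x\<close>, which is at
    least \<open>(1 - 2 * \<eta>) * x\<close>; omitting \<open>m\<close> arcs costs at most a factor
    \<open>exp m\<close>, since \<open>x \<le> N\<close>.\<close>
  have alpha_m: "\<alpha> ^ (n - m) \<le> exp (m - (1 - 2 * \<eta>) * x)" if "m \<le> 3" for m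
  proof -
    have "real (n - m) = N - m" using that N by (subst of_nat_diff) (simp_all add: N_def)
    moreover have "(1 - \<eta>) * p0 * (N - m) = (1 - \<eta>) * (p0 * N) * (1 - m / N)" using N by (simp add: field_simps)
    ultimately have "(1 - \<eta>) * p0 * (n - m) = (1 - \<eta>) * (p0 * N) * (1 - m / N)" by simp
    also have "\<dots> = (1 - \<eta>) * ((1 - \<eta>) * x) * (1 - m / N)" by (simp only: p0N)
    also have "\<dots> = (1 - \<eta>)\<^sup>2 * x - (1 - \<eta>)\<^sup>2 * (x / N) * m" by (simp add: power2_eq_square algebra_simps)
    finally have eq: "(1 - \<eta>) * p0 * (n - m) = (1 - \<eta>)\<^sup>2 * x - (1 - \<eta>)\<^sup>2 * (x / N) * m" .
    have "(1 - 2 * \<eta>) * x \<le> (1 - \<eta>)\<^sup>2 * x" using eta_sq x0 by (intro mult_right_mono) auto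
    moreover have "(1 - \<eta>)\<^sup>2 * (x / N) \<le> 1 * 1" using eta_sq(2) xN N x0 by (intro mult_mono) simp_all
    then have "(1 - \<eta>)\<^sup>2 * (x / N) * m \<le> 1 * real m" by (intro mult_right_mono) simp_all
    ultimately have "(1 - 2 * \<eta>) * x - m \<le> (1 - \<eta>) * p0 * (n - m)" unfolding eq by simp
    then show ?thesis by (intro order_trans[OF alpha_pow]) simp
  qed

  have t2: "10 * length P * n ^ 2 * ((1 / \<eta>) ^ L * \<alpha> ^ (n - 2) * p1 * \<phi> ^ (2 * s)) \<le>
      20 * l * (1 / \<eta>) ^ L * exp 2 * x * exp (- (\<gamma> / 2 * x))"
  proof -
    have "10 * length P * n ^ 2 * ((1 / \<eta>) ^ L * \<alpha> ^ (n - 2) * p1 * \<phi> ^ (2 * s)) \<le>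
      10 * l * N ^ 2 * ((1 / \<eta>) ^ L * exp (2 - (1 - 2 * \<eta>) * x) * p1 * exp (- (\<gamma> * x)))"
      unfolding l_def N_def using alpha_m[of 2] phi2s alpha phi p \<eta> by (intro mult_left_mono mult_mono) simp_all
    also have "\<dots> = 10 * l * (1 / \<eta>) ^ L * (p1 * N) * (exp x * exp (2 - (1 - 2 * \<eta>) * x) * exp (- (\<gamma> * x)))"
      unfolding expx by (simp add: power2_eq_square)
    also have "exp x * exp (2 - (1 - 2 * \<eta>) * x) * exp (- (\<gamma> * x)) = exp 2 * exp (- (\<gamma> / 2 * x))"
      unfolding \<gamma>(2) by (simp add: exp_add[symmetric] algebra_simps)
    finally show ?thesis by (simp add: p1N)
  qed

  have t3: "10 * length P * n * n ^ K * (p1 ^ K * \<phi> ^ (2 * s * K)) \<le> 10 * l * (2 * x) ^ K * exp (- x)"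
  proof -
    have "\<phi> ^ (2 * s * K) = (\<phi> ^ (2 * s)) ^ K" by (rule power_mult)
    also have "\<dots> \<le> exp (- (\<gamma> * x)) ^ K"
      by (rule power_mono[OF phi2s]) (intro zero_le_power phi)
    also have "\<dots> = exp (- (2 * x))"
    proof -
      have "real K * \<gamma> = 2" using r P(2) by (auto simp: K \<gamma>lr l_def)
      then have "real K * (- (\<gamma> * x)) = - (2 * x)" by (metis mult.assoc mult_minus_right)
      then show ?thesis by (simp only: exp_of_nat_mult[symmetric])
    qed
    finally have ph: "\<phi> ^ (2 * s * K) \<le> exp (- (2 * x))" .
    have "10 * length P * n * n ^ K * (p1 ^ K * \<phi> ^ (2 * s * K)) \<le> 10 * l * N * N ^ K * (p1 ^ K * exp (- (2 * x)))"
    proof -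
      have "real (10 * length P * n * n ^ K) = 10 * l * N * N ^ K" by (simp add: l_def N_def)
      moreover have "0 \<le> 10 * l * N * N ^ K" using l N by simp
      moreover have "p1 ^ K * \<phi> ^ (2 * s * K) \<le> p1 ^ K * exp (- (2 * x))" using ph p by (intro mult_left_mono) simp_all
      ultimately show ?thesis by (simp only: mult_left_mono)
    qed
    also have "\<dots> = 10 * l * (p1 * N) ^ K * (exp x * exp (- (2 * x)))"
      unfolding expx by (simp add: power_mult_distrib)
    also have "exp x * exp (- (2 * x)) = exp (- x)" by (simp add: exp_add[symmetric])
    finally show ?thesis by (simp add: p1N)
  qed

  \<comment> \<open>Two small degrees give \<open>n powr (\<gamma> - 2)\<close> up to constants,
    while \<open>n ^ 3 * p1 ^ 2\<close> is \<open>n\<close> up to logarithms; the total exponent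
    \<open>\<gamma> - 1\<close> is at most \<open>- 1 / 2\<close>.\<close>
  have t4: "n ^ 3 * ((1 / \<eta>) ^ (2 * L) * \<alpha> ^ (2 * (n - 3)) * p1 ^ 2) \<le>
      4 * (1 / \<eta>) ^ (2 * L) * exp 6 * x\<^sup>2 * exp (- (x / 2))"
  proof -
    have "\<alpha> ^ (2 * (n - 3)) = (\<alpha> ^ (n - 3)) ^ 2" by (simp only: power_mult[symmetric] mult.commute[of 2])
    also have "\<dots> \<le> exp (3 - (1 - 2 * \<eta>) * x) ^ 2"
      using alpha_m[of 3] alpha by (intro power_mono) simp_all
    also have "\<dots> = exp (6 - (2 - \<gamma>) * x)"
      unfolding \<gamma>(2) by (simp add: power2_eq_square exp_add[symmetric] algebra_simps)
    finally have al: "\<alpha> ^ (2 * (n - 3)) \<le> exp (6 - (2 - \<gamma>) * x)" .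
    have "n ^ 3 * ((1 / \<eta>) ^ (2 * L) * \<alpha> ^ (2 * (n - 3)) * p1 ^ 2) \<le>
       N ^ 3 * ((1 / \<eta>) ^ (2 * L) * exp (6 - (2 - \<gamma>) * x) * p1 ^ 2)"
      unfolding N_def of_nat_power using al p \<eta> by (intro mult_left_mono mult_right_mono) simp_all
    also have "\<dots> = (1 / \<eta>) ^ (2 * L) * (p1 * N)\<^sup>2 * (exp x * exp (6 - (2 - \<gamma>) * x))"
      unfolding expx by (simp add: power2_eq_square power3_eq_cube)
    also have "exp x * exp (6 - (2 - \<gamma>) * x) = exp 6 * exp (- ((1 - \<gamma>) * x))"
      by (simp add: exp_add[symmetric] algebra_simps)
    also have "(1 / \<eta>) ^ (2 * L) * (p1 * N)\<^sup>2 * (exp 6 * exp (- ((1 - \<gamma>) * x))) \<le>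
       (1 / \<eta>) ^ (2 * L) * (p1 * N)\<^sup>2 * (exp 6 * exp (- (x / 2)))"
    proof (intro mult_left_mono)
      have "1 / 2 * x \<le> (1 - \<gamma>) * x" using g x0 by (intro mult_right_mono) simp_all
      then show "exp (- ((1 - \<gamma>) * x)) \<le> exp (- (x / 2))" by simp
    qed (use \<eta> in simp_all)
    also have "(p1 * N)\<^sup>2 = 4 * x\<^sup>2" by (simp only: p1N power_mult_distrib) simp
    finally show ?thesis by (simp only: mult_ac)
  qed

  have t5: "(1 - (1 - p0) ^ (n - 1)) ^ n \<le> exp (- exp (\<eta> * x - 2))"
  proof -
    \<comment> \<open>A lower bound on the probability of having no out-neighbor is needed here,
      hence the quadratic term. It contributes at most a constant because
      \<open>N * p0\<^sup>2 \<le> 1\<close>, leaving about \<open>n powr \<eta>\<close> expected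
      such vertices.\<close>
    have "- p0 - 2 * p0\<^sup>2 \<le> ln (1 - p0)" using p(1) large(5) by (intro ln_one_minus_pos_lower_bound) auto
    then have "exp (- p0 - 2 * p0\<^sup>2) \<le> 1 - p0" using large(5) by (simp add: ln_ge_iff)
    then have "exp (- p0 - 2 * p0\<^sup>2) ^ n \<le> (1 - p0) ^ n" by (intro power_mono) simp_all
    also have "\<dots> \<le> (1 - p0) ^ (n - 1)" using p(1) large(5) by (intro power_decreasing) simp_all
    finally have low: "exp (N * (- p0 - 2 * p0\<^sup>2)) \<le> (1 - p0) ^ (n - 1)"
      by (simp only: N_def exp_of_nat_mult)
    have "N * p0\<^sup>2 = (p0 * N)\<^sup>2 / N" using N by (simp add: power2_eq_square)
    also have "\<dots> = (1 - \<eta>)\<^sup>2 * (x\<^sup>2 / N)" by (simp add: p0N power_mult_distrib)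
    also have "\<dots> \<le> 1 * 1" using eta_sq(2) xN N by (intro mult_mono) simp_all
    finally have "N * p0\<^sup>2 \<le> 1" by simp
    moreover have "N * (- p0 - 2 * p0\<^sup>2) = - ((1 - \<eta>) * x) - 2 * (N * p0\<^sup>2)"
      using p0N by (simp add: algebra_simps)
    ultimately have "- ((1 - \<eta>) * x) - 2 \<le> N * (- p0 - 2 * p0\<^sup>2)" by linarith
    then have low': "exp (- ((1 - \<eta>) * x) - 2) \<le> (1 - p0) ^ (n - 1)" using low by (meson exp_le_cancel_iff order_trans)
    have "(1 - (1 - p0) ^ (n - 1)) ^ n \<le> exp (- ((1 - p0) ^ (n - 1) * n))"
      using p(1) large(5) by (intro one_minus_power_le_exp) (simp_all add: power_le_one)
    also have "\<dots> \<le> exp (- (exp (- ((1 - \<eta>) * x) - 2) * N))"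
      using low' N unfolding N_def by (simp only: exp_le_cancel_iff neg_le_iff_le) (intro mult_right_mono, simp_all)
    also have "exp (- ((1 - \<eta>) * x) - 2) * N = exp (\<eta> * x - 2)"
      unfolding expx[symmetric] by (simp add: exp_add[symmetric] algebra_simps)
    finally show ?thesis .
  qed

  have t6: "2 * n * (1 - p1) ^ (n - 1) \<le> 2 * exp 2 * exp (- x)"
  proof -
    have "real (n - 1) = N - 1" using N by (subst of_nat_diff) (simp_all add: N_def)
    then have "p1 * (n - 1) = 2 * x - 2 * (x / N)" using p1N N by (simp add: p1 N_def field_simps)
    moreover have "x / N \<le> 1" using xN N by simp
    ultimately have "2 * x - 2 \<le> p1 * (n - 1)" by linarith
    then have "(1 - p1) ^ (n - 1) \<le> exp (2 - 2 * x)"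
      using p by (intro order_trans[OF one_minus_power_le_exp]) simp_all
    then have "2 * n * (1 - p1) ^ (n - 1) \<le> 2 * exp x * exp (2 - 2 * x)"
      unfolding expx N_def by (simp only: of_nat_mult of_nat_numeral) (intro mult_left_mono, simp_all)
    also have "\<dots> = 2 * exp 2 * exp (- x)" by (simp add: exp_add[symmetric])
    finally show ?thesis .
  qed

  show ?thesis
    using order_trans[OF prob_not_typical[of K L] add_mono[OF add_mono[OF add_mono[OF add_mono[OF add_mono[OF t1 t2] t3] t4] t5] t6]]
    by (simp only: failure_bound_def x_def l_def N_def)
qed

theorem theorem4:
  fixes r :: nat and P :: "nat list"
  assumes "r \<ge> 1"
    and "set P \<subseteq> {1..r}"
    and "\<forall>c\<in>{1..r}. c \<in> set P"
  shows "((\<lambda>n. measure_pmf.prob (full_process r n) {h. tau_connected P n h = tau_1 n h})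
           \<longlongrightarrow> 1) (inf at_top (principal {n. length P dvd n}))"
proof -
  \<comment> \<open>Since \<open>r \<ge> 1\<close>, color 1 exists and must occur in
    \<open>P\<close>.\<close>
  have lpos: "length P > 0" using assms(1,3) by force
  define l where "l = length P"
  define \<gamma> :: real where "\<gamma> = 1 / (40 * l * r)"
  define \<eta> where "\<eta> = \<gamma> / 4"
  define K where "K = 80 * l * r"
  define L where "L = 2 * (l * K + 2)"
  define p0 p1 :: "nat \<Rightarrow> real" where "p0 n = (1 - \<eta>) * ln n / n" and "p1 n = 2 * ln n / n" for n
  define s where "s n = n div (20 * l)" for n
  have l1: "l \<ge> 1" unfolding l_def using lpos by linarith
  have "1 * 1 \<le> real l * real r" using l1 assms(1) by (intro mult_mono) simp_all
  then have \<gamma>: "0 < \<gamma>" "\<gamma> \<le> 1" by (simp_all add: \<gamma>_def field_simps)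
  have \<eta>: "0 < \<eta>" "\<eta> \<le> 1 / 4" using \<gamma> by (simp_all add: \<eta>_def)
  let ?p = "\<lambda>n. measure_pmf.prob (full_process r n) {h. tau_connected P n h = tau_1 n h}"
  have bound: "1 - failure_bound \<gamma> l K L \<eta> r n \<le> ?p n"
    if n: "n \<ge> 40 * l" and big: "ln n \<ge> (1 :: real)" "(ln n)\<^sup>2 \<le> real n" "2 * ln n / n \<le> (1 / 2 :: real)" for n
  proof -
    have n0: "real n > 0" using n l1 by simp
    have s2: "s n \<ge> 2" using n l1 by (simp add: s_def div_le_mono[of "40 * l" n "20 * l"] less_eq_div_iff_mult_less_eq)
    have "20 * l * s n \<le> n" by (simp add: s_def)
    \<comment> \<open>Rounding down in \<open>s\<close> costs at most a factor of two, which turns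
      the 20 of the zone sizes into the 40 of the lower bound on \<open>s\<close>.\<close>
    have "n < 20 * l + 20 * l * (n div (20 * l))" using l1 by (intro dividend_less_times_div) simp
    also have "\<dots> = 20 * l * Suc (s n)" by (simp add: s_def)
    also have "\<dots> \<le> 20 * l * (s n + s n)" using s2 by (intro mult_le_mono2) simp
    also have "\<dots> = 40 * l * s n" by (simp add: algebra_simps)
    finally have sn: "n \<le> 40 * l * s n" by (rule less_imp_le)
    have "0 < p0 n" using \<eta> big n0 by (simp add: p0_def)
    moreover have "p0 n \<le> p1 n" using \<eta> big n0 unfolding p0_def p1_def by (intro divide_right_mono mult_right_mono) simp_all
    moreover have "p1 n \<le> 1 / 2" using big by (simp add: p1_def)
    ultimately interpret zone_model r n "p0 n" "p1 n" \<eta> P "s n"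
      by unfold_locales (use assms \<eta> lpos s2 \<open>20 * l * s n \<le> n\<close> in \<open>auto simp: l_def\<close>)
    have "measure_pmf.prob (full_process r n) {h. tau_connected P n h \<noteq> tau_1 n h} \<le> Om {f. \<not> typical n P (s n) K L f}"
    proof (rule prob_full_process_le[OF assms(1)])
      fix f h a b
      assume f: "f \<in> set_pmf (omega r n (marks (p0 n) (p1 n)))" and h: "h \<in> {h. tau_connected P n h \<noteq> tau_1 n h}"
        and full: "fst ` set h = all_arcs n" and col: "\<And>e. e \<in> all_arcs n \<Longrightarrow> coloring h e = snd (f e)"
        and ab: "arcs0 n f = fst ` set (take a h)" "arcs1 n f = fst ` set (take b h)"
      have "snd (f e) \<in> set P" if "e \<in> all_arcs n" for e
        using set_omega[OF assms(1) f that] assms(3) by blast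
      then show "f \<in> {f. \<not> typical n P (s n) K L f}"
        using typical_tau[OF _ _ s(1) _ full col _ ab, of P K L] h n2 by (auto simp: L_def l_def)
    qed
    also have "\<dots> \<le> failure_bound \<gamma> (length P) K L \<eta> r n"
      by (rule prob_not_typical_le_failure_bound)
        (use sn s2 big \<open>p0 n \<le> p1 n\<close> \<open>p1 n \<le> 1 / 2\<close> in \<open>simp_all add: \<gamma>_def \<eta>_def K_def p0_def p1_def l_def\<close>)
    finally have "measure_pmf.prob (full_process r n) {h. tau_connected P n h \<noteq> tau_1 n h} \<le> failure_bound \<gamma> l K L \<eta> r n"
      by (simp add: l_def)
    moreover have "{h. tau_connected P n h \<noteq> tau_1 n h} = UNIV - {h. tau_connected P n h = tau_1 n h}" by auto
    ultimately show ?thesis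
      using measure_pmf.prob_compl[of "{h. tau_connected P n h = tau_1 n h}" "full_process r n"] by simp
  qed
  have "eventually (\<lambda>n. n \<ge> 40 * l) at_top" by (rule eventually_ge_at_top)
  moreover have "eventually (\<lambda>n. ln (real n) \<ge> 1) at_top" by real_asymp
  moreover have "eventually (\<lambda>n. (ln (real n))\<^sup>2 \<le> real n) at_top" by real_asymp
  moreover have "eventually (\<lambda>n. 2 * ln (real n) / n \<le> 1 / 2) at_top" by real_asymp
  ultimately have ev: "eventually (\<lambda>n. 1 - failure_bound \<gamma> l K L \<eta> r n \<le> ?p n) at_top"
    by eventually_elim (rule bound)
  have "(\<lambda>n. 1 - failure_bound \<gamma> l K L \<eta> r n) \<longlonglongrightarrow> 1 - 0"
    using \<gamma> \<eta> l1 assms(1) by (intro tendsto_diff tendsto_const failure_bound_tendsto) simp_all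
  then have lim: "(\<lambda>n. 1 - failure_bound \<gamma> l K L \<eta> r n) \<longlonglongrightarrow> 1" by simp
  have "?p \<longlonglongrightarrow> 1"
    by (rule tendsto_sandwich[OF ev _ lim tendsto_const]) simp
  then show ?thesis by (rule tendsto_mono[rotated]) simp
qed

end
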